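(* Let $X$ and $Y$ be two identical compact hyper-cubes in $\mathbb{R}^d$ that share a hyper-surface of dimension $d'$, where $d'\in\{1,2,\dots,d-1\}$, and let $K\in\mathbb{R}^{T\times N}$ be the corresponding interaction (kernel) matrix, $K(i,j)=F(x_i,y_j)$, as set up in the context. Then for a given $\delta>0$ there exists a matrix $\tilde K$ with rank $p_\delta$ such that $$\frac{\|K-\tilde K\|_{\max}}{\|K\|_{\max}}<\delta,\qquad\text{where}\qquad p_\delta\in\mathcal{O}\left(N^{d'/d}\,\log^{d-d'}\left(\frac{N}{\delta}\right)\right).$$
   Context: Max norm: $\|K\|_{\max}=\max_{1\le i\le T,\,1\le j\le N}|K(i,j)|$. Geometry: $X,Y\subset\mathbb{R}^d$ are identical compact hyper-cubes of side $r$ with disjoint interiors. They share a hyper-surface of dimension $d'$ in the sense that $Y=X+r(1,\dots,1,\underbrace{0,\dots,0}_{d'})$; for example $Y=[0,r]^d$ and $X=[-r,0]^{d-d'}\times[0,r]^{d'}$. (For $d=3$, $d'=1$ is edge sharing and $d'=2$ is face sharing.) Sources and targets: $N=n^d$ ($n\in\mathbb{N}$) sources $y_1,\dots,y_N$ are uniformly distributed in the interior of $Y$, and $x_1,\dots,x_T$ are $T$ distinct target points in the interior of $X$. Kernel function: $F:\operatorname{interior}(X)\times\operatorname{interior}(Y)\to\mathbb{R}$. The function $F(x,y)$ is not analytic along $y=x$ and satisfies the analytic continuation assumption below. Bernstein ellipses: for $\rho>1$, $\mathcal{B}_\rho\subset\mathbb{C}$ is the interior of the ellipse $\{(\rho e^{it}+\rho^{-1}e^{-it})/2:\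 t\in[0,2\pi)\}$. For a hyper-cube $V=[a_1,b_1]\times\cdots\times[a_d,b_d]$ and $\rho'=(\rho_1,\dots,\rho_d)\in(1,\infty)^d$, the generalized Bernstein ellipse is $\mathcal{B}(V,\rho')=\tau_1(\mathcal{B}_{\rho_1})\times\cdots\times\tau_d(\mathcal{B}_{\rho_d})$, where $\tau_k(z)=\frac{a_k+b_k}{2}+\frac{b_k-a_k}{2}z$. Analytic continuation assumption: for compact hyper-cubes $U,V$ in $\mathbb{R}^d$ with $\operatorname{dist}(U,V)>0$ (Euclidean distance), the kernel $F:U\times V\to\mathbb{R}$ is analytically continuable to a generalized Bernstein ellipse, i.e. there exist a generalized Bernstein ellipse $\mathcal{B}(V,\rho')$ and an analytic function $F_a:U\times\mathcal{B}(V,\rho')\to\mathbb{C}$ whose restriction to $U\times V$ is $F$ and which is bounded on $U\times\mathcal{B}(V,\rho')$.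
   Formalization: Added: on subcubes V of Y with dist(X,V) ≥ side ≥ r/n, ellipse parameters are ≥ ρ0 > 1 and the bound of F_a is ≤ A·N^q·‖K‖max; the O-constant depends only on ρ0, A, q and the shared directions. Without such uniformity the claim fails. Also N ≥ 2, δ ≤ N. *)

theory Defs
  imports
    "Jordan_Normal_Form.DL_Rank"
    "HOL-Analysis.Analysis"
begin

no_notation Matrix.vec_index (infixl "$" 100)

definition hypercube :: "real^'d \<Rightarrow> real \<Rightarrow> (real^'d) set" where
  "hypercube c s = cbox c (c + (\<chi> k. s))"

text \<open>Displacement of \<open>Y\<close> from \<open>X\<close>. The set \<open>D\<close> plays the part of the last \<open>d'\<close> coordinates
  (the index type carries no order), so \<open>shift D r\<close> is \<open>r(1,\<dots>,1,0,\<dots>,0)\<close> up to relabelling.\<close>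

definition shift :: "'d set \<Rightarrow> real \<Rightarrow> real^'d" where
  "shift D r = (\<chi> k. if k \<in> D then 0 else r)"

definition bernstein :: "real \<Rightarrow> complex set" where
  "bernstein \<rho> = inside ((\<lambda>t. (of_real \<rho> * exp (\<i> * of_real t)
                              + inverse (of_real \<rho>) * exp (- \<i> * of_real t)) / 2) ` {0..<2 * pi})"

text \<open>\<open>\<B>(V, \<rho>)\<close> for \<open>V = hypercube c s\<close>: here \<open>a\<^sub>k = c $ k\<close> and \<open>b\<^sub>k = c $ k + s\<close>, so the affine
  map \<open>\<tau>\<^sub>k\<close> is \<open>z \<mapsto> c $ k + s/2 + (s/2) z\<close>.\<close>

definition gen_bernstein :: "real^'d \<Rightarrow> real \<Rightarrow> real^'d \<Rightarrow> (complex^'d) set" where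
  "gen_bernstein c s \<rho> =
     {z. \<forall>k. z $ k \<in> (\<lambda>w. of_real (c $ k + s / 2) + of_real (s / 2) * w) ` bernstein (\<rho> $ k)}"

text \<open>Analyticity in several complex variables on an open set, as complex differentiability at
  every point: the Frechet derivative exists and is complex linear.\<close>

definition analytic_several :: "(complex^'d \<Rightarrow> complex) \<Rightarrow> (complex^'d) set \<Rightarrow> bool" where
  "analytic_several f S \<longleftrightarrow>
     (\<forall>z\<in>S. \<exists>L. (f has_derivative L) (at z) \<and> (\<forall>a v. L (a *s v) = a * L v))"

text \<open>\<open>F\<close> continues from \<open>U \<times> V\<close>, \<open>V = hypercube c s\<close>, to \<open>U \<times> \<B>(V, \<rho>)\<close> with bound \<open>M\<close>. Only the
  values of \<open>F\<close> on \<open>interior X \<times> interior Y\<close>, its domain, are referred to.\<close>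

definition continues_to ::
  "(real^'d \<Rightarrow> real^'d \<Rightarrow> real) \<Rightarrow> (real^'d) set \<Rightarrow> (real^'d) set \<Rightarrow>
   (real^'d) set \<Rightarrow> real^'d \<Rightarrow> real \<Rightarrow> real^'d \<Rightarrow> real \<Rightarrow> bool" where
  "continues_to F X Y U c s \<rho> M \<longleftrightarrow>
     (\<exists>Fa :: real^'d \<Rightarrow> complex^'d \<Rightarrow> complex.
        (\<forall>x\<in>U. analytic_several (Fa x) (gen_bernstein c s \<rho>)) \<and>
        (\<forall>x\<in>U \<inter> interior X. \<forall>y\<in>hypercube c s \<inter> interior Y.
           Fa x (\<chi> k. of_real (y $ k)) = of_real (F x y)) \<and>
        (\<forall>x\<in>U. \<forall>z\<in>gen_bernstein c s \<rho>. norm (Fa x z) \<le> M))"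

text \<open>The analytic continuation assumption, with names for its existential witnesses: \<open>\<rho> U V\<close> is
  the parameter of the ellipse and \<open>M U V\<close> the bound belonging to the pair \<open>U, V\<close>. The assumption
  itself is \<open>\<exists>\<rho> M. analytic_continuation F X Y \<rho> M\<close>.\<close>

definition analytic_continuation ::
  "(real^'d \<Rightarrow> real^'d \<Rightarrow> real) \<Rightarrow> (real^'d) set \<Rightarrow> (real^'d) set \<Rightarrow>
   ((real^'d) set \<Rightarrow> (real^'d) set \<Rightarrow> real^'d) \<Rightarrow> ((real^'d) set \<Rightarrow> (real^'d) set \<Rightarrow> real) \<Rightarrow> bool" where
  "analytic_continuation F X Y \<rho> M \<longleftrightarrow>
     (\<forall>U V u t c s. U = hypercube u t \<and> V = hypercube c s \<and> 0 < t \<and> 0 < s \<and>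
        U \<subseteq> X \<and> V \<subseteq> Y \<and> 0 < setdist U V \<longrightarrow>
        (\<forall>k. 1 < \<rho> U V $ k) \<and> continues_to F X Y U c s (\<rho> U V) (M U V))"

text \<open>The parameters on which the constant in the \<open>\<O>\<close>-bound depends. On the well-separated subcubes
  \<open>V\<close> of \<open>Y\<close> (at distance from \<open>X\<close> at least their side) that are no smaller than the spacing
  \<open>h\<close> of the sources, the ellipse parameters are at least \<open>\<rho>\<^sub>0\<close> and the bounds at most \<open>M\<^sub>0\<close>.\<close>

definition continuation_constants ::
  "(real^'d) set \<Rightarrow> (real^'d) set \<Rightarrow> real \<Rightarrow>
   ((real^'d) set \<Rightarrow> (real^'d) set \<Rightarrow> real^'d) \<Rightarrow> ((real^'d) set \<Rightarrow> (real^'d) set \<Rightarrow> real) \<Rightarrow>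
   real \<Rightarrow> real \<Rightarrow> bool" where
  "continuation_constants X Y h \<rho> M \<rho>\<^sub>0 M\<^sub>0 \<longleftrightarrow>
     (\<forall>V c s. V = hypercube c s \<and> h \<le> s \<and> V \<subseteq> Y \<and> s \<le> setdist X V \<longrightarrow>
        (\<forall>k. \<rho>\<^sub>0 \<le> \<rho> X V $ k) \<and> M X V \<le> M\<^sub>0)"

text \<open>The \<open>N = n\<^sup>d\<close> sources \<open>y 0, \<dots>, y (N - 1)\<close> are uniformly distributed in \<open>Y = hypercube b r\<close>:
  when \<open>Y\<close> is cut into \<open>n\<^sup>d\<close> congruent cells, every cell contains exactly one source. Uniform grids
  are a special case.\<close>

definition uniformly_distributed :: "nat \<Rightarrow> real^'d \<Rightarrow> real \<Rightarrow> (nat \<Rightarrow> real^'d) \<Rightarrow> bool" where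
  "uniformly_distributed n b r y \<longleftrightarrow>
     (\<forall>j < n ^ CARD('d). y j \<in> interior (hypercube b r)) \<and>
     (\<forall>\<kappa> :: 'd \<Rightarrow> nat. (\<forall>k. \<kappa> k < n) \<longrightarrow>
        (\<exists>!j. j < n ^ CARD('d) \<and>
          (\<forall>k. b $ k + r * real (\<kappa> k) / real n \<le> y j $ k \<and>
               y j $ k < b $ k + r * (real (\<kappa> k) + 1) / real n)))"

definition kernel_matrix ::
  "('p \<Rightarrow> 'p \<Rightarrow> real) \<Rightarrow> nat \<Rightarrow> nat \<Rightarrow> (nat \<Rightarrow> 'p) \<Rightarrow> (nat \<Rightarrow> 'p) \<Rightarrow> real mat" where
  "kernel_matrix F T N x y = Matrix.mat T N (\<lambda>(i, j). F (x i) (y j))"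

definition max_norm :: "real mat \<Rightarrow> real" where
  "max_norm A = Max {\<bar>A $$ (i, j)\<bar> | i j. i < dim_row A \<and> j < dim_col A}"

abbreviation mat_rank :: "real mat \<Rightarrow> nat" where
  "mat_rank A \<equiv> vec_space.rank (dim_row A) A"

end

theory Submission
  imports Defs "HOL-Complex_Analysis.Cauchy_Integral_Formula"
begin

text \<open>
  Write \<open>d\<close> for the dimension and call the \<open>d - d'\<close> directions in which \<open>Y\<close> is displaced from \<open>X\<close>
  transversal. Cut \<open>Y\<close> dyadically towards the shared surface: level \<open>i\<close> consists of the points whose
  largest transversal distance from \<open>X\<close> lies between \<open>r / 2 ^ i\<close> and \<open>2 r / 2 ^ i\<close>. It is covered by
  cubes of side \<open>r / 2 ^ i\<close> that are at least that far from \<open>X\<close>. Their number is of order \<open>2 ^ (i d')\<close>,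
  because only the \<open>d'\<close> directions along the surface offer a growing number of positions
  (\<open>eps_rank_le_on_level\<close>).

  On such a cube the function \<open>y \<mapsto> F x y\<close> continues to a Bernstein ellipse with parameters at least
  \<open>\<rho>\<^sub>0\<close>, with a bound \<open>M\<^sub>0\<close> that does not depend on the cube. Tensor product interpolation with \<open>p\<close> nodes
  in each variable, at nodes that do not depend on \<open>x\<close>, approximates it up to \<open>O(M\<^sub>0 / 2 ^ p)\<close> by a sum
  of \<open>p ^ d\<close> products of a function of \<open>x\<close> and a function of \<open>y\<close> (\<open>tensor_interpolation_error\<close>,
  \<open>eps_rank_le_on_cell\<close>). Only the rank matters, so a cube may be cut further into a fixed number of
  cells, one for each interpolation. This number depends on \<open>\<rho>\<^sub>0\<close> and is chosen such that a
  polydisc around each cell fits into the ellipse (\<open>bernstein_margin_exists\<close>). On polydiscs,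
  interpolation at roots of unity replaces Chebyshev interpolation, and its Lebesgue constant is at
  most 2.

  Subdividing down to the spacing of the sources would give a rank of order \<open>n ^ d' p ^ d\<close>. The exponent
  \<open>d - d'\<close> results from stopping at the level \<open>\<kappa>\<close> with \<open>2 ^ \<kappa>\<close> about \<open>n / p\<close>. The levels up to \<open>\<kappa>\<close> form a
  geometric sum of order \<open>(2 ^ \<kappa>) ^ d' p ^ d\<close>, that is \<open>n ^ d' p ^ (d - d')\<close>. The sources nearer than
  \<open>r / 2 ^ \<kappa>\<close> to \<open>X\<close> are copied exactly. They fill a layer of \<open>n\<close> grid cells along the surface and
  about \<open>p\<close> across it, so their number is again of order \<open>n ^ d' p ^ (d - d')\<close>
  (\<open>kernel_matrix_approximation\<close>). Here \<open>n ^ d' = N powr (d' / d)\<close>.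

  Finally \<open>M\<^sub>0\<close> exceeds the max norm of \<open>K\<close> by a factor polynomial in \<open>N\<close> only, so the relative error is
  below \<open>\<delta>\<close> for some \<open>p = O(log (N / \<delta>))\<close> (\<open>order_sufficient\<close>). Two cases are separate: if \<open>p\<close> exceeds \<open>n\<close>, then
  \<open>K\<close> has few enough columns to serve as its own approximation; if \<open>\<delta>\<close> exceeds 1, the zero matrix does.
\<close>

section \<open>Interpolation at roots of unity\<close>

definition unity_node :: "nat \<Rightarrow> nat \<Rightarrow> complex" where
  "unity_node p q = cis (2 * pi * real q / real p)"

text \<open>The Lagrange basis polynomial of degree below \<open>p\<close> that is 1 at node \<open>q\<close> and 0 at the
  other \<open>p\<close>-th roots of unity, in expanded form.\<close>
definition unity_cardinal :: "nat \<Rightarrow> nat \<Rightarrow> complex \<Rightarrow> complex" where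
  "unity_cardinal p q w = (\<Sum>m<p. (w / unity_node p q) ^ m) / of_nat p"

lemma norm_unity_node [simp]: "norm (unity_node p q) = 1"
  by (simp add: unity_node_def)

lemma unity_node_nonzero [simp]: "unity_node p q \<noteq> 0"
  by (simp add: unity_node_def)

text \<open>For \<open>l \<noteq> m\<close> this is a full period of a geometric progression whose ratio is a root of unity
  other than 1.\<close>
lemma unity_node_orthogonal:
  assumes "m < p" "l < p"
  shows "(\<Sum>q<p. unity_node p q ^ m / unity_node p q ^ l) = (if l = m then of_nat p else 0)"
proof (cases "l = m")
  case True
  then show ?thesis by simp
next
  case False
  define z where "z = cis (2 * pi * (real m - real l) / real p)"
  have p: "p > 0" using assms by simp
  have pow: "unity_node p q ^ m / unity_node p q ^ l = z ^ q" for q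
    by (simp add: unity_node_def z_def Complex.DeMoivre cis_divide)
       (simp add: field_simps diff_divide_distrib)
  have zp: "z ^ p = 1"
  proof -
    have "z ^ p = cis (2 * pi * of_int (int m - int l))"
      using p by (simp add: z_def Complex.DeMoivre)
    then show ?thesis by (metis cis_multiple_2pi Ints_of_int)
  qed
  have z1: "z \<noteq> 1"
  proof
    assume "z = 1"
    then have "cos (2 * pi * (real m - real l) / real p) = 1"
      by (metis z_def cis.sel(1) one_complex.sel(1))
    then obtain i :: int where i: "2 * pi * (real m - real l) / real p = real_of_int i * 2 * pi"
      using cos_one_2pi_int by blast
    then have "2 * pi * (real m - real l) = 2 * pi * (real_of_int i * real p)"
      using p by (simp add: divide_eq_eq mult_ac)
    then have "real m - real l = real_of_int i * real p"
      using mult_left_cancel[of "2 * pi"] by simp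
    then have eq: "int m - int l = i * int p"
    proof -
      have "real_of_int (int m - int l) = real_of_int (i * int p)"
        using \<open>real m - real l = real_of_int i * real p\<close> by simp
      then show ?thesis by (simp only: of_int_eq_iff)
    qed
    have "i = 0"
    proof (rule ccontr)
      assume "i \<noteq> 0"
      then have "1 * int p \<le> \<bar>i\<bar> * int p" by (intro mult_right_mono) auto
      then have "int p \<le> \<bar>i * int p\<bar>" by (simp add: abs_mult)
      moreover have "\<bar>int m - int l\<bar> < int p" using assms by linarith
      ultimately show False using eq by simp
    qed
    then show False using eq False by simp
  qed
  have "(\<Sum>q<p. z ^ q) = 0"
    using z1 zp by (simp add: geometric_sum)
  then show ?thesis using False by (simp add: pow)
qed

lemma unity_interpolation_exact:
  assumes "m < p"
  shows "(\<Sum>q<p. unity_cardinal p q w * unity_node p q ^ m) = w ^ m"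
proof -
  have "(\<Sum>q<p. unity_cardinal p q w * unity_node p q ^ m)
      = (\<Sum>q<p. \<Sum>l<p. w ^ l * (unity_node p q ^ m / unity_node p q ^ l) / of_nat p)"
    by (simp add: unity_cardinal_def sum_distrib_right sum_divide_distrib power_divide)
  also have "\<dots> = (\<Sum>l<p. \<Sum>q<p. w ^ l * (unity_node p q ^ m / unity_node p q ^ l) / of_nat p)"
    by (rule sum.swap)
  also have "\<dots> = (\<Sum>l<p. w ^ l / of_nat p * (\<Sum>q<p. unity_node p q ^ m / unity_node p q ^ l))"
    by (simp add: sum_distrib_left mult_ac)
  also have "\<dots> = (\<Sum>l<p. if l = m then w ^ m else 0)"
    by (rule sum.cong) (use assms in \<open>auto simp: unity_node_orthogonal\<close>)
  also have "\<dots> = w ^ m" using assms by simp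
  finally show ?thesis .
qed

text \<open>The monomials in the expanded form decay geometrically on the disc of half the radius of the
  node circle.\<close>
lemma norm_unity_cardinal:
  assumes "norm w \<le> 1/2"
  shows "norm (unity_cardinal p q w) \<le> 2 / real p"
proof -
  have "norm (\<Sum>m<p. (w / unity_node p q) ^ m) \<le> (\<Sum>m<p. (1/2::real) ^ m)"
    by (rule sum_norm_le)
       (metis assms norm_power norm_divide norm_unity_node div_by_1 norm_ge_zero power_mono)
  also have "\<dots> \<le> 2"
    by (simp add: geometric_sum)
  finally show ?thesis
    by (simp add: unity_cardinal_def norm_divide divide_right_mono)
qed

text \<open>The Lebesgue constant on the disc of radius \<open>1/2\<close> is at most 2, for every number of nodes.
  This is why the nodes are taken on a circle: interpolating in \<open>d\<close> variables one after the
  other amplifies the error by \<open>2 ^ d\<close> only, a factor that does not grow with \<open>p\<close>.\<close>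
lemma unity_lebesgue:
  assumes "norm w \<le> 1/2" "\<And>q. q < p \<Longrightarrow> norm (v q) \<le> e" "0 \<le> e"
  shows "norm (\<Sum>q<p. unity_cardinal p q w * v q) \<le> 2 * e"
proof (cases "p = 0")
  case False
  have "norm (unity_cardinal p q w * v q) \<le> 2 / real p * e" if "q < p" for q
    unfolding norm_mult using that by (intro mult_mono norm_unity_cardinal assms) auto
  then have "norm (\<Sum>q<p. unity_cardinal p q w * v q) \<le> (\<Sum>q<p. 2 / real p * e)"
    by (intro sum_norm_le) auto
  then show ?thesis using False by simp
qed (use assms in auto)

text \<open>Cauchy's estimate on the circle of radius 2 bounds the \<open>m\<close>-th Taylor coefficient by
  \<open>M / 2 ^ m\<close>.\<close>
lemma taylor_tail:
  assumes hol: "g holomorphic_on ball 0 3" and bd: "\<And>z. norm z < 3 \<Longrightarrow> norm (g z) \<le> M"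
    and w: "norm w \<le> 1"
  shows "norm (g w - (\<Sum>m<p. (deriv ^^ m) g 0 / fact m * w ^ m)) \<le> 2 * M / 2 ^ p"
proof -
  define a where "a m = (deriv ^^ m) g 0 / fact m" for m
  have M: "0 \<le> M" using order_trans[OF norm_ge_zero bd[of 0]] by simp
  have a: "norm (a m) \<le> M / 2 ^ m" for m
  proof -
    have "norm ((deriv ^^ m) g 0) \<le> fact m * M / 2 ^ m"
    proof (rule Cauchy_inequality)
      show "g holomorphic_on ball 0 2" by (rule holomorphic_on_subset[OF hol]) auto
      show "continuous_on (cball 0 2) g"
        by (rule holomorphic_on_imp_continuous_on[OF holomorphic_on_subset[OF hol]]) auto
    qed (use bd in auto)
    then show ?thesis
      by (simp add: a_def norm_divide field_simps)
  qed
  have s: "(\<lambda>m. a m * w ^ m) sums g w"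
    using holomorphic_power_series[OF hol, of w] w by (simp add: a_def)
  then have tail: "(\<lambda>m. a (m + p) * w ^ (m + p)) sums (g w - (\<Sum>m<p. a m * w ^ m))"
    by (rule sums_split_initial_segment)
  have geom: "(\<lambda>m. M / 2 ^ p * (1/2) ^ m) sums (M / 2 ^ p * 2)"
    using geometric_sums[of "1/2::real"] by (intro sums_mult) auto
  have "norm (a (m + p) * w ^ (m + p)) \<le> M / 2 ^ p * (1/2) ^ m" for m
  proof -
    have "norm (a (m + p) * w ^ (m + p)) \<le> M / 2 ^ (m + p) * 1"
      unfolding norm_mult norm_power
      by (intro mult_mono a power_le_one w) (use M in auto)
    then show ?thesis by (simp add: power_add power_one_over field_simps)
  qed
  then have "norm (\<Sum>m. a (m + p) * w ^ (m + p)) \<le> (\<Sum>m. M / 2 ^ p * (1/2) ^ m)"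
    by (rule norm_suminf_le) (rule sums_summable[OF geom])
  then have "norm (g w - (\<Sum>m<p. a m * w ^ m)) \<le> M / 2 ^ p * 2"
    unfolding sums_unique[OF tail, symmetric] sums_unique[OF geom, symmetric] .
  then show ?thesis by (simp add: a_def mult.commute)
qed

text \<open>Interpolation reproduces the Taylor polynomial \<open>T\<close> of degree below \<open>p\<close>, so the error is that of
  \<open>g - T\<close>: its value at \<open>w\<close> plus, by the Lebesgue constant, twice its maximum at the nodes.\<close>
lemma unity_interpolation_error:
  assumes hol: "g holomorphic_on ball 0 3" and bd: "\<And>z. norm z < 3 \<Longrightarrow> norm (g z) \<le> M"
    and w: "norm w \<le> 1/2"
  shows "norm (g w - (\<Sum>q<p. unity_cardinal p q w * g (unity_node p q))) \<le> 6 * M / 2 ^ p"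
proof -
  define a where "a m = (deriv ^^ m) g 0 / fact m" for m
  define T where "T z = (\<Sum>m<p. a m * z ^ m)" for z
  have M: "0 \<le> M" using order_trans[OF norm_ge_zero bd[of 0]] by simp
  have tail: "norm (g z - T z) \<le> 2 * M / 2 ^ p" if "norm z \<le> 1" for z
    unfolding T_def a_def by (rule taylor_tail[OF hol bd that])
  have exact: "(\<Sum>q<p. unity_cardinal p q w * T (unity_node p q)) = T w"
  proof -
    have "(\<Sum>q<p. unity_cardinal p q w * T (unity_node p q))
        = (\<Sum>q<p. \<Sum>m<p. a m * (unity_cardinal p q w * unity_node p q ^ m))"
      by (simp add: T_def sum_distrib_left mult_ac)
    also have "\<dots> = (\<Sum>m<p. \<Sum>q<p. a m * (unity_cardinal p q w * unity_node p q ^ m))"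
      by (rule sum.swap)
    also have "\<dots> = (\<Sum>m<p. a m * (\<Sum>q<p. unity_cardinal p q w * unity_node p q ^ m))"
      by (simp only: sum_distrib_left)
    also have "\<dots> = T w"
      unfolding T_def by (rule sum.cong) (simp_all add: unity_interpolation_exact)
    finally show ?thesis .
  qed
  have "g w - (\<Sum>q<p. unity_cardinal p q w * g (unity_node p q))
      = (g w - T w) - (\<Sum>q<p. unity_cardinal p q w * (g (unity_node p q) - T (unity_node p q)))"
    by (simp add: right_diff_distrib sum_subtractf exact)
  also have "norm \<dots> \<le> 2 * M / 2 ^ p + 2 * (2 * M / 2 ^ p)"
    by (rule order_trans[OF norm_triangle_ineq4])
       (intro add_mono unity_lebesgue tail, use w M in auto)
  finally show ?thesis by simp
qed

text \<open>Interpolation in one more variable adds one one-variable error and doubles the previous error,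
  by the Lebesgue constant. The approximant uses values of \<open>f\<close> only, so holomorphy of \<open>f\<close> in each variable
  separately suffices. The variables outside \<open>S\<close> range over the disc of radius 3 because in the
  induction they are replaced by nodes, which lie outside the disc of radius \<open>1/2\<close>.\<close>
lemma tensor_interpolation_error:
  fixes f :: "('k \<Rightarrow> complex) \<Rightarrow> complex"
  assumes hol: "\<And>z k. \<forall>j. norm (z j) < 3 \<Longrightarrow> (\<lambda>w. f (z(k := w))) holomorphic_on ball 0 3"
    and bd: "\<And>z. \<forall>j. norm (z j) < 3 \<Longrightarrow> norm (f z) \<le> M"
    and "finite S" and "\<forall>j. norm (z j) < 3" and "\<forall>j\<in>S. norm (z j) \<le> 1/2"
  shows "norm (f z - (\<Sum>\<beta>\<in>PiE S (\<lambda>_. {..<p}).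
            (\<Prod>k\<in>S. unity_cardinal p (\<beta> k) (z k)) * f (\<lambda>j. if j \<in> S then unity_node p (\<beta> j) else z j)))
         \<le> (2 ^ card S - 1) * (6 * M / 2 ^ p)"
  using assms(3-5)
proof (induction S arbitrary: z rule: finite_induct)
  case empty
  then show ?case by simp
next
  case (insert k S)
  let ?e = "6 * M / 2 ^ p"
  let ?G = "\<lambda>z. \<Sum>\<beta>\<in>PiE S (\<lambda>_. {..<p}).
       (\<Prod>k\<in>S. unity_cardinal p (\<beta> k) (z k)) * f (\<lambda>j. if j \<in> S then unity_node p (\<beta> j) else z j)"
  have M: "0 \<le> M" by (rule order_trans[OF norm_ge_zero bd[OF insert.prems(1)]])
  have zk: "norm (z k) \<le> 1/2" using insert.prems by auto
  have in3: "\<forall>j. norm ((z(k := unity_node p q)) j) < 3" for q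
    using insert.prems(1) by auto
  have G: "norm (f (z(k := unity_node p q)) - ?G (z(k := unity_node p q))) \<le> (2 ^ card S - 1) * ?e" for q
    by (rule insert.IH[OF in3]) (use insert.prems insert.hyps in auto)
  have "(\<Sum>\<beta>\<in>PiE (insert k S) (\<lambda>_. {..<p}). (\<Prod>i\<in>insert k S. unity_cardinal p (\<beta> i) (z i)) *
          f (\<lambda>j. if j \<in> insert k S then unity_node p (\<beta> j) else z j))
      = (\<Sum>(q, \<beta>)\<in>{..<p} \<times> PiE S (\<lambda>_. {..<p}). unity_cardinal p q (z k) *
          ((\<Prod>i\<in>S. unity_cardinal p (\<beta> i) ((z(k := unity_node p q)) i)) *
          f (\<lambda>j. if j \<in> S then unity_node p (\<beta> j) else (z(k := unity_node p q)) j)))"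
    unfolding PiE_insert_eq
  proof (subst sum.reindex[OF inj_combinator[OF insert.hyps(2)]], rule sum.cong[OF refl], clarify)
    fix q \<beta> assume "\<beta> \<in> PiE S (\<lambda>_. {..<p})"
    have "(\<Prod>i\<in>S. unity_cardinal p ((\<beta>(k := q)) i) (z i)) =
          (\<Prod>i\<in>S. unity_cardinal p (\<beta> i) ((z(k := unity_node p q)) i))"
      using insert.hyps(2) by (intro prod.cong) auto
    moreover have "(\<lambda>j. if j \<in> insert k S then unity_node p ((\<beta>(k := q)) j) else z j)
        = (\<lambda>j. if j \<in> S then unity_node p (\<beta> j) else (z(k := unity_node p q)) j)"
      using insert.hyps(2) by auto
    ultimately show "((\<lambda>\<beta>. (\<Prod>i\<in>insert k S. unity_cardinal p (\<beta> i) (z i)) *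
          f (\<lambda>j. if j \<in> insert k S then unity_node p (\<beta> j) else z j)) \<circ> (\<lambda>(y, g). g(k := y))) (q, \<beta>) =
       unity_cardinal p q (z k) *
          ((\<Prod>i\<in>S. unity_cardinal p (\<beta> i) ((z(k := unity_node p q)) i)) *
          f (\<lambda>j. if j \<in> S then unity_node p (\<beta> j) else (z(k := unity_node p q)) j))"
      unfolding o_def case_prod_conv using insert.hyps by (simp add: mult.assoc)
  qed
  also have "\<dots> = (\<Sum>q<p. unity_cardinal p q (z k) * ?G (z(k := unity_node p q)))"
    by (simp add: sum.cartesian_product[symmetric] sum_distrib_left)
  finally have eq: "(\<Sum>\<beta>\<in>PiE (insert k S) (\<lambda>_. {..<p}). (\<Prod>i\<in>insert k S. unity_cardinal p (\<beta> i) (z i)) *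
          f (\<lambda>j. if j \<in> insert k S then unity_node p (\<beta> j) else z j))
      = (\<Sum>q<p. unity_cardinal p q (z k) * ?G (z(k := unity_node p q)))" .
  have one: "norm (f z - (\<Sum>q<p. unity_cardinal p q (z k) * f (z(k := unity_node p q)))) \<le> ?e"
    using unity_interpolation_error[OF hol[OF insert.prems(1), of k], of M "z k" p] zk insert.prems(1)
    by (simp add: bd)
  have "f z - (\<Sum>q<p. unity_cardinal p q (z k) * ?G (z(k := unity_node p q)))
      = (f z - (\<Sum>q<p. unity_cardinal p q (z k) * f (z(k := unity_node p q))))
        + (\<Sum>q<p. unity_cardinal p q (z k) * (f (z(k := unity_node p q)) - ?G (z(k := unity_node p q))))"
    by (simp only: right_diff_distrib sum_subtractf) simp
  also have "norm \<dots> \<le> ?e + 2 * ((2 ^ card S - 1) * ?e)"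
    by (intro order_trans[OF norm_triangle_ineq] add_mono one unity_lebesgue zk G) (use M in auto)
  also have "\<dots> = (2 ^ card (insert k S) - 1) * ?e"
  proof -
    have "e + 2 * ((c - 1) * e) = (2 * c - 1) * e" for c e :: real
      by (simp add: algebra_simps)
    then show ?thesis using insert.hyps by (simp only: card_insert_disjoint power_Suc not_False_eq_True)
  qed
  finally show ?case unfolding eq .
qed

section \<open>A uniform neighbourhood of the interval inside all Bernstein ellipses\<close>

lemma exp_ellipse:
  "(of_real \<rho> * exp (\<i> * of_real t) + inverse (of_real \<rho>) * exp (- \<i> * of_real t)) / 2
     = Complex ((\<rho> + 1/\<rho>) / 2 * cos t) ((\<rho> - 1/\<rho>) / 2 * sin t)"
proof -
  have "exp (- \<i> * complex_of_real t) = cis (- t)"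
    by (simp add: cis_conv_exp)
  moreover have "exp (\<i> * complex_of_real t) = cis t"
    by (simp add: cis_conv_exp)
  moreover have "inverse (complex_of_real \<rho>) = of_real (inverse \<rho>)"
    by simp
  ultimately show ?thesis
    by (simp add: complex_eq_iff inverse_eq_divide algebra_simps del: of_real_inverse)
qed

text \<open>The curve defining \<open>bernstein \<rho>\<close> is the whole level set \<open>Q = 1\<close> of the quadratic form \<open>Q\<close> with
  semi-axes \<open>\<alpha>\<close> and \<open>\<beta>\<close>. A connected set that avoids it and meets \<open>Q < 1\<close> stays within \<open>Q < 1\<close>,
  which is bounded.\<close>
lemma ellipse_interior_subset_bernstein:
  fixes \<rho> :: real
  defines "\<alpha> \<equiv> (\<rho> + 1/\<rho>) / 2" and "\<beta> \<equiv> (\<rho> - 1/\<rho>) / 2"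
  assumes "1 < \<rho>" and z: "(Re z / \<alpha>)\<^sup>2 + (Im z / \<beta>)\<^sup>2 < 1"
  shows "z \<in> bernstein \<rho>"
proof -
  define Q where "Q = (\<lambda>z. (Re z / \<alpha>)\<^sup>2 + (Im z / \<beta>)\<^sup>2)"
  have ab: "0 < \<alpha>" "0 < \<beta>"
    using \<open>1 < \<rho>\<close> by (auto simp: \<alpha>_def \<beta>_def field_simps intro: less_1_mult add_pos_pos)
  define C where "C = (\<lambda>t. (of_real \<rho> * exp (\<i> * of_real t)
                              + inverse (of_real \<rho>) * exp (- \<i> * of_real t)) / 2 :: complex) ` {0..<2 * pi}"
  have C: "C = (\<lambda>t. Complex (\<alpha> * cos t) (\<beta> * sin t)) ` {0..<2 * pi}"
    unfolding C_def exp_ellipse \<alpha>_def \<beta>_def ..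
  have level: "w \<in> C" if "Q w = 1" for w
  proof -
    have "(Re w / \<alpha>)\<^sup>2 + (Im w / \<beta>)\<^sup>2 = 1" using that by (simp add: Q_def)
    then obtain t where t: "0 \<le> t" "t < 2 * pi" and "Re w / \<alpha> = cos t" "Im w / \<beta> = sin t"
      by (rule sincos_total_2pi)
    then have "w = Complex (\<alpha> * cos t) (\<beta> * sin t)"
      using ab by (simp add: complex_eq_iff field_simps)
    then show ?thesis
      using t unfolding C by auto
  qed
  have "Q w = 1" if "w \<in> C" for w
    using that ab unfolding C Q_def by auto
  then have zC: "z \<notin> C" using z unfolding Q_def by (metis less_irrefl)
  have lt: "Q w < 1" if w: "w \<in> connected_component_set (- C) z" for w
  proof (rule ccontr)
    assume "\<not> Q w < 1"
    let ?K = "connected_component_set (- C) z"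
    have "continuous_on ?K Q"
      unfolding Q_def using ab by (intro continuous_intros) auto
    then have "connected (Q ` ?K)"
      by (intro connected_continuous_image connected_connected_component)
    moreover have "Q z \<in> Q ` ?K" "Q w \<in> Q ` ?K"
      using zC w by (auto simp: connected_component_refl)
    ultimately have "1 \<in> Q ` ?K"
      using z \<open>\<not> Q w < 1\<close> unfolding connected_iff_interval by (metis Q_def less_eq_real_def not_less)
    then obtain v where "v \<in> ?K" "Q v = 1" by auto
    then show False using level connected_component_subset by fastforce
  qed
  have "bounded (connected_component_set (- C) z)"
  proof (rule boundedI)
    fix w assume "w \<in> connected_component_set (- C) z"
    then have "Q w < 1" by (rule lt)
    then have "(Re w / \<alpha>)\<^sup>2 < 1" "(Im w / \<beta>)\<^sup>2 < 1"
      unfolding Q_def using zero_le_power2[of "Re w / \<alpha>"] zero_le_power2[of "Im w / \<beta>"] by linarith+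
    then have "\<bar>Re w / \<alpha>\<bar> < 1" "\<bar>Im w / \<beta>\<bar> < 1"
      using abs_square_less_1 by blast+
    then have "\<bar>Re w\<bar> \<le> \<alpha>" "\<bar>Im w\<bar> \<le> \<beta>"
      using ab by (simp_all add: abs_divide)
    then show "norm w \<le> \<alpha> + \<beta>" using cmod_le[of w] by linarith
  qed
  then show ?thesis using zC unfolding bernstein_def inside_def C_def by blast
qed

text \<open>A neighbourhood of \<open>[-1, 1]\<close> common to all the ellipses. Everything that follows uses only discs of
  radius \<open>\<eta>\<close> in place of the ellipses themselves, with constants that depend on \<open>\<rho>\<^sub>0\<close> alone.\<close>
definition bernstein_margin :: "real \<Rightarrow> real \<Rightarrow> bool" where
  "bernstein_margin \<rho>\<^sub>0 \<eta> \<longleftrightarrow>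
     (\<forall>\<rho> u z. \<rho>\<^sub>0 \<le> \<rho> \<and> \<bar>u\<bar> \<le> 1 \<and> norm (z - of_real u) < \<eta> \<longrightarrow> z \<in> bernstein \<rho>)"

text \<open>Both semi-axes increase with \<open>\<rho>\<close>, so \<open>\<rho> = \<rho>\<^sub>0\<close> is the worst case; there the major semi-axis
  exceeds 1, which leaves room for a small \<open>\<eta>\<close> by continuity.\<close>
lemma bernstein_margin_exists:
  assumes "1 < \<rho>\<^sub>0"
  obtains \<eta> where "0 < \<eta>" "bernstein_margin \<rho>\<^sub>0 \<eta>"
proof -
  define \<alpha> \<beta> where "\<alpha> = (\<lambda>\<rho>::real. (\<rho> + 1/\<rho>) / 2)" and "\<beta> = (\<lambda>\<rho>::real. (\<rho> - 1/\<rho>) / 2)"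
  have b0: "0 < \<beta> \<rho>\<^sub>0" using assms by (auto simp: \<beta>_def field_simps intro: less_1_mult)
  have a0: "1 < \<alpha> \<rho>\<^sub>0"
  proof -
    have "0 < (\<rho>\<^sub>0 - 1)\<^sup>2 / \<rho>\<^sub>0" using assms by auto
    then show ?thesis using assms by (simp add: \<alpha>_def field_simps power2_eq_square)
  qed
  have "((\<lambda>h. ((1 + h) / \<alpha> \<rho>\<^sub>0)\<^sup>2 + (h / \<beta> \<rho>\<^sub>0)\<^sup>2) \<longlongrightarrow> ((1 + 0) / \<alpha> \<rho>\<^sub>0)\<^sup>2 + (0 / \<beta> \<rho>\<^sub>0)\<^sup>2) (at_right 0)"
    using a0 b0 by (intro tendsto_intros) auto
  moreover have "((1 + 0) / \<alpha> \<rho>\<^sub>0)\<^sup>2 + (0 / \<beta> \<rho>\<^sub>0)\<^sup>2 < 1"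
    using a0 by (simp add: power_divide)
  ultimately have "\<forall>\<^sub>F h in at_right 0. ((1 + h) / \<alpha> \<rho>\<^sub>0)\<^sup>2 + (h / \<beta> \<rho>\<^sub>0)\<^sup>2 < 1"
    by (rule order_tendstoD)
  then obtain \<eta> where \<eta>: "0 < \<eta>" "((1 + \<eta>) / \<alpha> \<rho>\<^sub>0)\<^sup>2 + (\<eta> / \<beta> \<rho>\<^sub>0)\<^sup>2 < 1"
    unfolding eventually_at_right_field by (metis dense)
  have "z \<in> bernstein \<rho>" if h: "\<rho>\<^sub>0 \<le> \<rho>" "\<bar>u\<bar> \<le> 1" "norm (z - of_real u) < \<eta>" for \<rho> u z
  proof (rule ellipse_interior_subset_bernstein)
    show "1 < \<rho>" using assms h by simp
    have inv: "1/\<rho> \<le> 1/\<rho>\<^sub>0" using assms h by (simp add: frac_le)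
    \<comment> \<open>the left-hand side is twice the increment of the major semi-axis\<close>
    have "(\<rho> - \<rho>\<^sub>0) * (1 - 1/(\<rho> * \<rho>\<^sub>0)) \<ge> 0"
      using assms h less_1_mult[of \<rho> \<rho>\<^sub>0] by (intro mult_nonneg_nonneg) auto
    then have al: "\<alpha> \<rho>\<^sub>0 \<le> \<alpha> \<rho>" using assms h by (simp add: \<alpha>_def field_simps)
    have be: "\<beta> \<rho>\<^sub>0 \<le> \<beta> \<rho>" using inv h by (simp add: \<beta>_def)
    have re: "\<bar>Re z\<bar> \<le> 1 + \<eta>" using abs_Re_le_cmod[of "z - of_real u"] h by simp
    have im: "\<bar>Im z\<bar> \<le> \<eta>" using abs_Im_le_cmod[of "z - of_real u"] h by simp
    have "\<bar>Re z / \<alpha> \<rho>\<bar> \<le> (1 + \<eta>) / \<alpha> \<rho>\<^sub>0"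
      using re al a0 by (simp add: abs_divide) (intro frac_le; simp)
    moreover have "\<bar>Im z / \<beta> \<rho>\<bar> \<le> \<eta> / \<beta> \<rho>\<^sub>0"
      using im be b0 by (simp add: abs_divide) (intro frac_le; simp)
    ultimately have "(Re z / \<alpha> \<rho>)\<^sup>2 + (Im z / \<beta> \<rho>)\<^sup>2 \<le> ((1 + \<eta>) / \<alpha> \<rho>\<^sub>0)\<^sup>2 + (\<eta> / \<beta> \<rho>\<^sub>0)\<^sup>2"
      by (metis add_mono abs_ge_zero power2_abs power_mono)
    then show "(Re z / ((\<rho> + 1/\<rho>) / 2))\<^sup>2 + (Im z / ((\<rho> - 1/\<rho>) / 2))\<^sup>2 < 1"
      using \<eta>(2) by (simp add: \<alpha>_def \<beta>_def)
  qed
  then show ?thesis using that \<eta>(1) unfolding bernstein_margin_def by blast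
qed

section \<open>Rank up to a tolerance\<close>

text \<open>The \<open>\<epsilon>\<close>-rank of a kernel on a product set. Working with functions and point sets instead of matrix
  blocks makes the bound additive over arbitrary covers of the sources.\<close>
definition eps_rank_le :: "('a \<Rightarrow> 'b \<Rightarrow> real) \<Rightarrow> 'a set \<Rightarrow> 'b set \<Rightarrow> real \<Rightarrow> nat \<Rightarrow> bool" where
  "eps_rank_le h A B \<epsilon> R \<longleftrightarrow>
     (\<exists>f g. \<forall>x\<in>A. \<forall>y\<in>B. \<bar>h x y - (\<Sum>t<R. f t x * g t y)\<bar> \<le> \<epsilon>)"

lemma eps_rank_leI:
  assumes "finite I"
    and "\<And>x y. x \<in> A \<Longrightarrow> y \<in> B \<Longrightarrow> \<bar>h x y - (\<Sum>t\<in>I. f t x * g t y)\<bar> \<le> \<epsilon>"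
  shows "eps_rank_le h A B \<epsilon> (card I)"
proof -
  obtain e where e: "bij_betw e {..<card I} I"
    using ex_bij_betw_nat_finite[OF assms(1)] by (auto simp: atLeast0LessThan)
  have "(\<Sum>t<card I. f (e t) x * g (e t) y) = (\<Sum>t\<in>I. f t x * g t y)" for x y
    using sum.reindex_bij_betw[OF e, of "\<lambda>t. f t x * g t y"] .
  then show ?thesis
    unfolding eps_rank_le_def using assms(2)
    by (intro exI[of _ "\<lambda>t. f (e t)"] exI[of _ "\<lambda>t. g (e t)"]) simp
qed

lemma eps_rank_le_mono:
  assumes "eps_rank_le h A B' \<epsilon>' R'" "B \<subseteq> B'" "\<epsilon>' \<le> \<epsilon>" "R' \<le> R"
  shows "eps_rank_le h A B \<epsilon> R"
proof -
  obtain f g where fg: "\<And>x y. x \<in> A \<Longrightarrow> y \<in> B' \<Longrightarrow> \<bar>h x y - (\<Sum>t<R'. f t x * g t y)\<bar> \<le> \<epsilon>'"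
    using assms(1) unfolding eps_rank_le_def by blast
  have "(\<Sum>t<R. (if t < R' then f t x else 0) * g t y) = (\<Sum>t<R'. f t x * g t y)" for x y
    using assms(4) by (intro sum.mono_neutral_cong_right) auto
  moreover have "\<bar>h x y - (\<Sum>t<R'. f t x * g t y)\<bar> \<le> \<epsilon>" if "x \<in> A" "y \<in> B" for x y
    using fg[of x y] that assms(2,3) by fastforce
  ultimately show ?thesis
    unfolding eps_rank_le_def
    by (intro exI[of _ "\<lambda>t x. if t < R' then f t x else 0"] exI[of _ g]) simp
qed

text \<open>On the overlap the approximation for \<open>B1\<close> is used, so the second one is cut off there.\<close>
lemma eps_rank_le_Un:
  assumes "eps_rank_le h A B1 \<epsilon> R1" "eps_rank_le h A B2 \<epsilon> R2"
  shows "eps_rank_le h A (B1 \<union> B2) \<epsilon> (R1 + R2)"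
proof -
  obtain f1 g1 where 1: "\<And>x y. x \<in> A \<Longrightarrow> y \<in> B1 \<Longrightarrow> \<bar>h x y - (\<Sum>t<R1. f1 t x * g1 t y)\<bar> \<le> \<epsilon>"
    using assms(1) unfolding eps_rank_le_def by blast
  obtain f2 g2 where 2: "\<And>x y. x \<in> A \<Longrightarrow> y \<in> B2 \<Longrightarrow> \<bar>h x y - (\<Sum>t<R2. f2 t x * g2 t y)\<bar> \<le> \<epsilon>"
    using assms(2) unfolding eps_rank_le_def by blast
  define f where "f t = (if t < R1 then f1 t else f2 (t - R1))" for t
  define g where "g t y = (if t < R1 then (if y \<in> B1 then g1 t y else 0)
                                     else (if y \<in> B1 then 0 else g2 (t - R1) y))" for t y
  have split: "(\<Sum>t<R1 + R2. f t x * g t y)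
      = (\<Sum>t<R1. f t x * g t y) + (\<Sum>t<R2. f (R1 + t) x * g (R1 + t) y)" for x y
    by (induction R2) (simp_all add: add.assoc)
  have "(\<Sum>t<R1 + R2. f t x * g t y)
      = (if y \<in> B1 then (\<Sum>t<R1. f1 t x * g1 t y) else (\<Sum>t<R2. f2 t x * g2 t y))" for x y
    unfolding split by (simp add: f_def g_def)
  then show ?thesis
    unfolding eps_rank_le_def using 1 2 by (intro exI[of _ f] exI[of _ g]) auto
qed

lemma eps_rank_le_UN:
  assumes "finite \<Gamma>" "0 \<le> \<epsilon>" "\<And>\<gamma>. \<gamma> \<in> \<Gamma> \<Longrightarrow> eps_rank_le h A (B \<gamma>) \<epsilon> (R \<gamma>)"
  shows "eps_rank_le h A (\<Union>\<gamma>\<in>\<Gamma>. B \<gamma>) \<epsilon> (\<Sum>\<gamma>\<in>\<Gamma>. R \<gamma>)"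
  using assms(1,3)
proof (induction \<Gamma> rule: finite_induct)
  case empty
  then show ?case by (simp add: eps_rank_le_def)
next
  case (insert \<gamma> \<Gamma>)
  then show ?case using eps_rank_le_Un[of h A "B \<gamma>" \<epsilon> "R \<gamma>"] by simp
qed

text \<open>Finitely many sources can be copied exactly, one term for each.\<close>
lemma eps_rank_le_card:
  assumes "finite B" "0 \<le> \<epsilon>"
  shows "eps_rank_le h A B \<epsilon> (card B)"
proof (rule eps_rank_leI[where f = "\<lambda>t x. h x t" and g = "\<lambda>t y. if y = t then 1 else 0"])
  fix x y assume "y \<in> B"
  then have "(\<Sum>t\<in>B. h x t * (if y = t then 1 else 0)) = h x y"
    using assms(1) by (simp add: if_distrib sum.delta cong: if_cong)
  then show "\<bar>h x y - (\<Sum>t\<in>B. h x t * (if y = t then 1 else 0))\<bar> \<le> \<epsilon>"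
    using assms(2) by simp
qed (rule assms)

lemma rank_sum_products_le:
  "vec_space.rank m (Matrix.mat m n (\<lambda>(i, j). \<Sum>t<R. f t i * g t j :: real)) \<le> R"
proof (induction R)
  case 0
  have "Matrix.mat m n (\<lambda>(i, j). \<Sum>t<0. f t i * g t j) = 0\<^sub>m m n"
    by (rule eq_matI) auto
  moreover have "vec_space.rank m (0\<^sub>m m n :: real mat) = 0"
    by (rule vec_space.rank_0I)
  ultimately show ?case by (simp only: order_refl)
next
  case (Suc R)
  let ?A = "Matrix.mat m n (\<lambda>(i, j). \<Sum>t<R. f t i * g t j)"
  let ?B = "Matrix.mat m n (\<lambda>(i, j). f R i * g R j)"
  have "Matrix.mat m n (\<lambda>(i, j). \<Sum>t<Suc R. f t i * g t j) = ?A + ?B" by auto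
  moreover have "vec_space.rank m (?A + ?B) \<le> vec_space.rank m ?A + vec_space.rank m ?B"
    by (rule vec_space.rank_subadditive) auto
  moreover have "vec_space.rank m ?B \<le> 1"
    by (rule vec_space.rank_le_1_product_entries[of _ _ n "f R" "g R"]) auto
  ultimately show ?case using Suc by simp
qed

lemma eps_rank_le_imp_kernel_matrix:
  assumes "eps_rank_le F A B \<epsilon> R" "x ` {..<T} \<subseteq> A" "y ` {..<N} \<subseteq> B"
  obtains K' where "K' \<in> carrier_mat T N" "mat_rank K' \<le> R"
    "\<And>i j. i < T \<Longrightarrow> j < N \<Longrightarrow> \<bar>(kernel_matrix F T N x y - K') $$ (i, j)\<bar> \<le> \<epsilon>"
proof -
  obtain f g where fg: "\<And>u v. u \<in> A \<Longrightarrow> v \<in> B \<Longrightarrow> \<bar>F u v - (\<Sum>t<R. f t u * g t v)\<bar> \<le> \<epsilon>"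
    using assms(1) unfolding eps_rank_le_def by blast
  let ?K = "Matrix.mat T N (\<lambda>(i, j). \<Sum>t<R. f t (x i) * g t (y j))"
  show ?thesis
  proof
    show "?K \<in> carrier_mat T N" by simp
    show "mat_rank ?K \<le> R"
      using rank_sum_products_le[of T N "\<lambda>t i. f t (x i)" "\<lambda>t j. g t (y j)" R] by simp
    show "\<bar>(kernel_matrix F T N x y - ?K) $$ (i, j)\<bar> \<le> \<epsilon>" if "i < T" "j < N" for i j
      using that fg[of "x i" "y j"] assms(2,3) by (auto simp: kernel_matrix_def)
  qed
qed

lemma max_norm_less:
  assumes "0 < dim_row A" "0 < dim_col A"
    and "\<And>i j. i < dim_row A \<Longrightarrow> j < dim_col A \<Longrightarrow> \<bar>A $$ (i, j)\<bar> < c"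
  shows "max_norm A < c"
proof -
  let ?S = "{\<bar>A $$ (i, j)\<bar> | i j. i < dim_row A \<and> j < dim_col A}"
  have "?S = (\<lambda>(i, j). \<bar>A $$ (i, j)\<bar>) ` ({..<dim_row A} \<times> {..<dim_col A})" by auto
  then have "finite ?S" by simp
  moreover have "?S \<noteq> {}" using assms by auto
  ultimately show ?thesis unfolding max_norm_def using assms(3) by (subst Max_less_iff) auto
qed

section \<open>Low rank on a well-separated cell\<close>

lemma mem_hypercube: "y \<in> hypercube c s \<longleftrightarrow> (\<forall>k. c $ k \<le> y $ k \<and> y $ k \<le> c $ k + s)"
  by (simp add: hypercube_def mem_box_cart)

lemma mem_interior_hypercube:
  "y \<in> interior (hypercube c s) \<longleftrightarrow> (\<forall>k. c $ k < y $ k \<and> y $ k < c $ k + s)"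
  by (simp add: hypercube_def interior_cbox mem_box_cart)

text \<open>The affine map of \<open>hypercube c s\<close> onto \<open>[-1, 1]\<close> in coordinate \<open>k\<close> scales lengths by \<open>2/s\<close>, so the
  margin \<open>\<eta>\<close> becomes the radius \<open>\<eta> s / 2\<close>.\<close>
lemma polydisc_in_gen_bernstein:
  assumes margin: "bernstein_margin \<rho>\<^sub>0 \<eta>"
    and \<rho>: "\<And>k. \<rho>\<^sub>0 \<le> \<rho> $ k" and "0 < s" and \<gamma>: "\<gamma> \<in> hypercube c s"
    and z: "\<And>k. norm (z $ k - of_real (\<gamma> $ k)) < \<eta> * s / 2"
  shows "z \<in> gen_bernstein c s \<rho>"
  unfolding gen_bernstein_def mem_Collect_eq
proof
  fix k
  define u where "u = (\<gamma> $ k - (c $ k + s / 2)) / (s / 2)"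
  define w where "w = (z $ k - of_real (c $ k + s / 2)) / of_real (s / 2)"
  have "c $ k \<le> \<gamma> $ k" "\<gamma> $ k \<le> c $ k + s" using \<gamma> by (auto simp: mem_hypercube)
  then have "u \<le> 1" "- 1 \<le> u" using \<open>0 < s\<close> by (simp_all add: u_def field_simps)
  then have u: "\<bar>u\<bar> \<le> 1" by linarith
  have "w - of_real u = (z $ k - of_real (\<gamma> $ k)) / of_real (s / 2)"
    by (simp add: w_def u_def diff_divide_distrib add_divide_distrib)
  then have "norm (w - of_real u) = norm (z $ k - of_real (\<gamma> $ k)) / (s / 2)"
    using \<open>0 < s\<close> by (simp add: norm_divide del: of_real_divide)
  also have "\<dots> < \<eta>" using z[of k] \<open>0 < s\<close> by (simp add: divide_less_eq)
  finally have "w \<in> bernstein (\<rho> $ k)" using margin \<rho>[of k] u unfolding bernstein_margin_def by simp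
  moreover have "z $ k = of_real (c $ k + s / 2) + of_real (s / 2) * w"
    using \<open>0 < s\<close> by (simp add: w_def del: of_real_divide of_real_add)
  ultimately show "z $ k \<in> (\<lambda>w. of_real (c $ k + s / 2) + of_real (s / 2) * w) ` bernstein (\<rho> $ k)"
    by blast
qed

lemma analytic_several_holomorphic_slice:
  fixes f :: "complex^'d \<Rightarrow> complex"
  assumes an: "analytic_several f S" and in_S: "\<And>w. w \<in> B \<Longrightarrow> u + w *s v \<in> S"
  shows "(\<lambda>w. f (u + w *s v)) holomorphic_on B"
proof (rule holomorphic_onI)
  fix w assume "w \<in> B"
  then obtain L where L: "(f has_derivative L) (at (u + w *s v))" and lin: "\<And>a x. L (a *s x) = a * L x"
    using an in_S unfolding analytic_several_def by blast
  have "linear (\<lambda>w::complex. w *s v)"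
    by (rule linearI) (simp_all add: vec_eq_iff algebra_simps)
  then have "bounded_linear (\<lambda>w::complex. w *s v)"
    by (simp add: linear_conv_bounded_linear)
  then have "((\<lambda>w. u + w *s v) has_derivative (\<lambda>w. w *s v)) (at w within B)"
    by (auto intro!: derivative_eq_intros bounded_linear_imp_has_derivative)
  then have "((\<lambda>w. f (u + w *s v)) has_derivative (\<lambda>h. L (h *s v))) (at w within B)"
    by (rule has_derivative_compose) (rule L)
  moreover have "(\<lambda>h. L (h *s v)) = (*) (L v)" by (auto simp: lin mult.commute)
  ultimately have "((\<lambda>w. f (u + w *s v)) has_derivative (*) (L v)) (at w within B)"
    by (simp only:)
  then show "(\<lambda>w. f (u + w *s v)) field_differentiable (at w within B)"
    unfolding field_differentiable_def has_field_derivative_def by (rule exI)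
qed

text \<open>A cell is a cube of side \<open>t\<close> with centre \<open>\<gamma>\<close>. In units of \<open>t\<close> it lies in the polydisc of radius
  \<open>1/2\<close>, the interpolation nodes have radius 1, and \<open>f\<close> is analytic up to radius 3.\<close>
lemma interpolation_error_on_cell:
  fixes f :: "complex^'d \<Rightarrow> complex" and \<gamma> :: "real^'d"
  assumes an: "analytic_several f S" and bd: "\<And>z. z \<in> S \<Longrightarrow> norm (f z) \<le> M"
    and "0 < t" and disc: "\<And>z. (\<And>k. norm (z $ k - of_real (\<gamma> $ k)) < 3 * t) \<Longrightarrow> z \<in> S"
    and y: "\<And>k. \<bar>y $ k - \<gamma> $ k\<bar> \<le> t / 2"
  shows "norm (f (\<chi> k. of_real (y $ k))
           - (\<Sum>\<beta>\<in>PiE UNIV (\<lambda>_. {..<p}). (\<Prod>k\<in>UNIV. unity_cardinal p (\<beta> k) (of_real ((y $ k - \<gamma> $ k) / t)))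
               * f (\<chi> k. of_real (\<gamma> $ k) + of_real t * unity_node p (\<beta> k))))
         \<le> (2 ^ CARD('d) - 1) * (6 * M / 2 ^ p)"
proof -
  define \<phi> where "\<phi> z = (\<chi> k. complex_of_real (\<gamma> $ k) + of_real t * z k)" for z :: "'d \<Rightarrow> complex"
  define z where "z k = complex_of_real ((y $ k - \<gamma> $ k) / t)" for k
  have in_S: "\<phi> z \<in> S" if "\<forall>j. norm (z j) < 3" for z
    using that \<open>0 < t\<close> by (intro disc) (simp add: \<phi>_def norm_mult mult.commute)
  have hol: "(\<lambda>w. f (\<phi> (z(k := w)))) holomorphic_on ball 0 3" if "\<forall>j. norm (z j) < 3" for z k
  proof -
    have upd: "\<phi> (z(k := w)) = \<phi> (z(k := 0)) + w *s axis k (of_real t)" for w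
      by (simp add: \<phi>_def vec_eq_iff axis_def)
    have "\<phi> (z(k := w)) \<in> S" if "w \<in> ball 0 3" for w
      using that \<open>\<forall>j. norm (z j) < 3\<close> by (intro in_S) auto
    then have "(\<lambda>w. f (\<phi> (z(k := 0)) + w *s axis k (of_real t))) holomorphic_on ball 0 3"
      using upd by (intro analytic_several_holomorphic_slice[OF an]) metis
    moreover have "(\<lambda>w. f (\<phi> (z(k := w)))) = (\<lambda>w. f (\<phi> (z(k := 0)) + w *s axis k (of_real t)))"
      by (rule ext, rule arg_cong[where f = f, OF upd])
    ultimately show ?thesis by (simp only:)
  qed
  have z: "norm (z k) \<le> 1/2" for k
    using y[of k] \<open>0 < t\<close> by (simp add: z_def norm_divide field_simps del: of_real_divide of_real_diff)
  have z3: "\<forall>k. norm (z k) < 3"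
  proof
    show "norm (z k) < 3" for k using z[of k] by linarith
  qed
  have "\<phi> z = (\<chi> k. of_real (y $ k))"
    using \<open>0 < t\<close> by (simp add: \<phi>_def z_def vec_eq_iff)
  then show ?thesis
    using tensor_interpolation_error[of "f \<circ> \<phi>" M UNIV z p] hol bd in_S z z3
    by (simp add: o_def \<phi>_def[symmetric] z_def[symmetric]) (simp add: \<phi>_def z_def)
qed

text \<open>The nodes depend on the cell only, so the interpolant is a sum of \<open>p ^ d\<close> products of a complex
  function of \<open>x\<close> and one of \<open>y\<close>. Its real part needs two real products for each, which is the
  factor 2 in the rank.\<close>
lemma eps_rank_le_on_cell:
  fixes F :: "real^'d \<Rightarrow> real^'d \<Rightarrow> real"
  assumes margin: "bernstein_margin \<rho>\<^sub>0 \<eta>"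
    and cont: "continues_to F X Y X c s \<rho> M" and \<rho>: "\<And>k. \<rho>\<^sub>0 \<le> \<rho> $ k"
    and "0 < s" and \<gamma>: "\<gamma> \<in> hypercube c s" and t: "0 < t" "3 * t \<le> \<eta> * s / 2"
  shows "eps_rank_le F (interior X) {y \<in> hypercube c s \<inter> interior Y. \<forall>k. \<bar>y $ k - \<gamma> $ k\<bar> \<le> t / 2}
           ((2 ^ CARD('d) - 1) * (6 * M / 2 ^ p)) (2 * p ^ CARD('d))"
proof -
  obtain Fa where an: "\<And>x. x \<in> X \<Longrightarrow> analytic_several (Fa x) (gen_bernstein c s \<rho>)"
    and ext: "\<And>x y. x \<in> X \<inter> interior X \<Longrightarrow> y \<in> hypercube c s \<inter> interior Y \<Longrightarrow>
                 Fa x (\<chi> k. of_real (y $ k)) = of_real (F x y)"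
    and bd: "\<And>x z. x \<in> X \<Longrightarrow> z \<in> gen_bernstein c s \<rho> \<Longrightarrow> norm (Fa x z) \<le> M"
    using cont unfolding continues_to_def by blast
  define I where "I = PiE (UNIV :: 'd set) (\<lambda>_. {..<p}) \<times> (UNIV :: bool set)"
  define P where "P \<beta> y = (\<Prod>k\<in>UNIV. unity_cardinal p (\<beta> k) (of_real ((y $ k - \<gamma> $ k) / t)))"
    for \<beta> and y :: "real^'d"
  define C where "C \<beta> x = Fa x (\<chi> k. of_real (\<gamma> $ k) + of_real t * unity_node p (\<beta> k))" for \<beta> x
  define f where "f i x = (if snd i then Re (C (fst i) x) else Im (C (fst i) x))" for i x
  define g where "g i y = (if snd i then Re (P (fst i) y) else - Im (P (fst i) y))" for i y
  have "finite I" unfolding I_def by (intro finite_cartesian_product finite_PiE) auto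
  moreover have "\<bar>F x y - (\<Sum>i\<in>I. f i x * g i y)\<bar> \<le> (2 ^ CARD('d) - 1) * (6 * M / 2 ^ p)"
    if x: "x \<in> interior X" and y: "y \<in> {y \<in> hypercube c s \<inter> interior Y. \<forall>k. \<bar>y $ k - \<gamma> $ k\<bar> \<le> t / 2}"
    for x y
  proof -
    have xX: "x \<in> X" using x interior_subset by blast
    let ?S = "\<Sum>\<beta>\<in>PiE UNIV (\<lambda>_. {..<p}). P \<beta> y * C \<beta> x"
    have "(\<Sum>i\<in>I. f i x * g i y) = (\<Sum>\<beta>\<in>PiE UNIV (\<lambda>_. {..<p}). \<Sum>s\<in>UNIV. f (\<beta>, s) x * g (\<beta>, s) y)"
      unfolding I_def by (simp add: sum.cartesian_product)
    also have "\<dots> = Re ?S"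
      by (simp add: UNIV_bool f_def g_def mult.commute)
    finally have Re: "(\<Sum>i\<in>I. f i x * g i y) = Re ?S" .
    have err: "norm (Fa x (\<chi> k. of_real (y $ k)) - ?S) \<le> (2 ^ CARD('d) - 1) * (6 * M / 2 ^ p)"
      unfolding P_def C_def
    proof (rule interpolation_error_on_cell[OF an[OF xX] bd[OF xX] t(1)])
      show "z \<in> gen_bernstein c s \<rho>" if "\<And>k. norm (z $ k - of_real (\<gamma> $ k)) < 3 * t" for z
        by (rule polydisc_in_gen_bernstein[OF margin \<rho> \<open>0 < s\<close> \<gamma>]) (rule less_le_trans[OF that t(2)])
    qed (use y in auto)
    have diff: "F x y - Re ?S = Re (Fa x (\<chi> k. of_real (y $ k)) - ?S)"
      using ext[of x y] x xX y by simp
    show ?thesis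
      unfolding Re diff by (rule order_trans[OF abs_Re_le_cmod err])
  qed
  ultimately have "eps_rank_le F (interior X) {y \<in> hypercube c s \<inter> interior Y. \<forall>k. \<bar>y $ k - \<gamma> $ k\<bar> \<le> t / 2}
      ((2 ^ CARD('d) - 1) * (6 * M / 2 ^ p)) (card I)"
    by (rule eps_rank_leI)
  moreover have "card I = 2 * p ^ CARD('d)"
    by (simp add: I_def card_cartesian_product card_PiE UNIV_bool)
  ultimately show ?thesis by simp
qed

section \<open>Dyadic levels and the layer of near sources\<close>

text \<open>Level \<open>i\<close> is covered by cubes \<open>V\<close> of side \<open>s = r / 2 ^ i\<close> whose distance from \<open>X\<close> is at least
  \<open>s\<close>; the lower bound on the distance comes from the one coordinate that is known to be large.
  Each \<open>V\<close> is cut into cells of side \<open>t = s / m\<close>, with \<open>m\<close> so large that the polydiscs of radius \<open>3 t\<close>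
  fit into the ellipse of \<open>V\<close>. In a direction of \<open>D\<close> there are \<open>m 2 ^ i\<close> positions for a cell, in any
  other direction only \<open>2 m\<close>, which is what limits the growth with \<open>i\<close> to \<open>(2 ^ i) ^ card D\<close>.\<close>
lemma eps_rank_le_on_level:
  fixes F :: "real^'d \<Rightarrow> real^'d \<Rightarrow> real" and D :: "'d set"
  assumes margin: "bernstein_margin \<rho>\<^sub>0 \<eta>"
    and m: "0 < m" "6 \<le> \<eta> * real m"
    and "0 < r" and b: "b = a + shift D r" and X: "X = hypercube a r" and Y: "Y = hypercube b r"
    and cont: "analytic_continuation F X Y \<rho> M"
    and const: "continuation_constants X Y (r / real n) \<rho> M \<rho>\<^sub>0 M\<^sub>0" and "0 \<le> M\<^sub>0"
    and i: "1 \<le> i" "2 ^ i \<le> n"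
  shows "eps_rank_le F (interior X)
           {y \<in> interior Y. (\<forall>k. k \<notin> D \<longrightarrow> y $ k - b $ k < 2 * r / 2 ^ i) \<and>
                            (\<exists>k. k \<notin> D \<and> r / 2 ^ i \<le> y $ k - b $ k)}
           ((2 ^ CARD('d) - 1) * (6 * M\<^sub>0 / 2 ^ p))
           ((2 * m) ^ CARD('d) * (2 ^ i) ^ card D * (2 * p ^ CARD('d)))"
proof -
  let ?\<epsilon> = "(2 ^ CARD('d) - 1) * (6 * M\<^sub>0 / 2 ^ p)"
  let ?B = "{y \<in> interior Y. (\<forall>k. k \<notin> D \<longrightarrow> y $ k - b $ k < 2 * r / 2 ^ i) \<and>
                            (\<exists>k. k \<notin> D \<and> r / 2 ^ i \<le> y $ k - b $ k)}"
  define s where "s = r / 2 ^ i"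
  define t where "t = s / real m"
  have s: "0 < s" and t: "0 < t" and smt: "s = real m * t" and rs: "r = 2 ^ i * s"
    using \<open>0 < r\<close> m by (auto simp: s_def t_def)
  have n: "0 < n" using i(2) by (cases n) simp_all
  define cells where "cells = PiE (UNIV :: 'd set) (\<lambda>k. {..<(if k \<in> D then m * 2 ^ i else 2 * m)})"
  define \<Gamma> where "\<Gamma> = {\<nu> \<in> cells. \<exists>k. k \<notin> D \<and> m \<le> \<nu> k}"
  define B where "B \<nu> = {y \<in> interior Y. \<forall>k. real (\<nu> k) * t \<le> y $ k - b $ k \<and>
                                           y $ k - b $ k \<le> (real (\<nu> k) + 1) * t}" for \<nu> :: "'d \<Rightarrow> nat"
  have fin_cells: "finite cells" unfolding cells_def by (intro finite_PiE) auto
  have "card \<Gamma> \<le> card cells" unfolding \<Gamma>_def by (intro card_mono fin_cells) auto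
  also have "card cells = (\<Prod>k\<in>UNIV. if k \<in> D then m * 2 ^ i else 2 * m)"
    by (simp add: cells_def card_PiE)
  also have "\<dots> \<le> (\<Prod>k\<in>UNIV. 2 * m * (if k \<in> D then 2 ^ i else 1))"
    by (intro prod_mono) auto
  also have "\<dots> = (2 * m) ^ CARD('d) * (2 ^ i) ^ card D"
    by (simp add: prod.distrib prod.If_cases)
  finally have card: "card \<Gamma> \<le> (2 * m) ^ CARD('d) * (2 ^ i) ^ card D" .
  have \<epsilon>: "0 \<le> ?\<epsilon>"
    using \<open>0 \<le> M\<^sub>0\<close> by (intro mult_nonneg_nonneg divide_nonneg_nonneg) auto
  have cell: "eps_rank_le F (interior X) (B \<nu>) ?\<epsilon> (2 * p ^ CARD('d))" if \<nu>: "\<nu> \<in> \<Gamma>" for \<nu>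
  proof -
    \<comment> \<open>the corner of the cube \<open>V\<close> that contains the cell with index \<open>\<nu>\<close>, and the centre of the cell\<close>
    define c where "c = (\<chi> k. b $ k + s * real (\<nu> k div m))"
    define \<gamma> where "\<gamma> = (\<chi> k. b $ k + t * (real (\<nu> k) + 1/2))"
    have lo: "s * real (\<nu> k div m) \<le> t * real (\<nu> k)" for k
    proof -
      have "real (m * (\<nu> k div m)) \<le> real (\<nu> k)" by (simp only: of_nat_le_iff times_div_less_eq_dividend)
      then have "t * (real m * real (\<nu> k div m)) \<le> t * real (\<nu> k)" using t by simp
      then show ?thesis by (simp add: smt mult_ac)
    qed
    have hi: "t * (real (\<nu> k) + 1) \<le> s * real (\<nu> k div m) + s" for k
    proof -
      have "\<nu> k < m + m * (\<nu> k div m)" using m(1) by (simp add: dividend_less_times_div)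
      then have "real (\<nu> k + 1) \<le> real (m * (\<nu> k div m + 1))"
        by (simp only: of_nat_le_iff) simp
      then have "real (\<nu> k) + 1 \<le> real m * (real (\<nu> k div m) + 1)"
        by (simp add: algebra_simps)
      then have "t * (real (\<nu> k) + 1) \<le> t * (real m * (real (\<nu> k div m) + 1))"
        using t by (intro mult_left_mono) auto
      then show ?thesis by (simp add: smt algebra_simps)
    qed
    let ?V = "hypercube c s"
    have "\<nu> k div m < 2 ^ i" for k
    proof -
      have "(2::nat) ^ 1 \<le> 2 ^ i" using i(1) by (intro power_increasing) auto
      then have "(if k \<in> D then m * 2 ^ i else 2 * m) \<le> 2 ^ i * m" by simp
      moreover have "\<nu> k < (if k \<in> D then m * 2 ^ i else 2 * m)"
        using \<nu> by (auto simp: \<Gamma>_def cells_def PiE_iff)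
      ultimately have "\<nu> k < 2 ^ i * m" by (rule less_le_trans[rotated])
      then show ?thesis by (rule less_mult_imp_div_less)
    qed
    then have "real (\<nu> k div m + 1) \<le> real (2 ^ i)" for k
      unfolding of_nat_le_iff by (simp only: Suc_eq_plus1[symmetric] Suc_le_eq)
    then have "s * (real (\<nu> k div m) + 1) \<le> s * 2 ^ i" for k
      using s by (simp add: add.commute)
    then have cr: "c $ k + s \<le> b $ k + r" for k
      by (simp add: c_def rs algebra_simps)
    have bc: "b $ k \<le> c $ k" for k using s by (simp add: c_def)
    have VY: "?V \<subseteq> Y"
    proof
      fix v assume v: "v \<in> ?V"
      have "b $ k \<le> v $ k \<and> v $ k \<le> b $ k + r" for k
        using v[unfolded mem_hypercube, rule_format, of k] bc[of k] cr[of k] by linarith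
      then show "v \<in> Y" by (simp add: Y mem_hypercube)
    qed
    obtain k0 where k0: "k0 \<notin> D" "m \<le> \<nu> k0" using \<nu> by (auto simp: \<Gamma>_def)
    have "1 \<le> \<nu> k0 div m" using k0(2) m(1) by (simp add: div_greater_zero_iff Suc_le_eq)
    then have ck0: "b $ k0 + s \<le> c $ k0" using s by (simp add: c_def)
    have sep: "s \<le> setdist X ?V"
    proof (rule le_setdistI)
      have "a \<in> X" "c \<in> ?V" using \<open>0 < r\<close> s by (simp_all add: X mem_hypercube)
      then show "X \<noteq> {}" "?V \<noteq> {}" by blast+
      fix u v assume "u \<in> X" "v \<in> ?V"
      then have "u $ k0 \<le> b $ k0" "c $ k0 \<le> v $ k0"
        using k0(1) by (auto simp: X b mem_hypercube shift_def)
      then have "s \<le> v $ k0 - u $ k0" using ck0 by linarith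
      also have "\<dots> \<le> dist (u $ k0) (v $ k0)" by (simp add: dist_real_def)
      also have "\<dots> \<le> dist u v" by (rule dist_vec_nth_le)
      finally show "s \<le> dist u v" .
    qed
    have "real (2 ^ i) \<le> real n" using i(2) by (simp only: of_nat_le_iff)
    then have "r / real n \<le> s"
      using \<open>0 < r\<close> n unfolding s_def by (intro divide_left_mono) auto
    then have \<rho>: "\<And>k. \<rho>\<^sub>0 \<le> \<rho> X ?V $ k" and M: "M X ?V \<le> M\<^sub>0"
      using const[unfolded continuation_constants_def, rule_format, of ?V c s] VY sep by simp_all
    have cont_V: "continues_to F X Y X c s (\<rho> X ?V) (M X ?V)"
      using cont[unfolded analytic_continuation_def, rule_format, of X a r ?V c s]
        X VY \<open>0 < r\<close> s less_le_trans[OF s sep] by simp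
    have \<gamma>V: "\<gamma> \<in> ?V"
      unfolding mem_hypercube
    proof
      fix k
      show "c $ k \<le> \<gamma> $ k \<and> \<gamma> $ k \<le> c $ k + s"
        using lo[of k] hi[of k] t by (simp add: c_def \<gamma>_def algebra_simps)
    qed
    have "3 * t \<le> \<eta> * s / 2"
    proof -
      have "t * 6 \<le> t * (\<eta> * real m)" using m(2) t by (intro mult_left_mono) auto
      then show ?thesis by (simp add: smt mult_ac)
    qed
    from eps_rank_le_on_cell[OF margin cont_V \<rho> s \<gamma>V t this]
    have "eps_rank_le F (interior X) {y \<in> ?V \<inter> interior Y. \<forall>k. \<bar>y $ k - \<gamma> $ k\<bar> \<le> t / 2}
            ((2 ^ CARD('d) - 1) * (6 * M X ?V / 2 ^ p)) (2 * p ^ CARD('d))" .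
    then show ?thesis
    proof (rule eps_rank_le_mono)
      show "(2 ^ CARD('d) - 1) * (6 * M X ?V / 2 ^ p) \<le> ?\<epsilon>"
        using M by (intro mult_left_mono divide_right_mono) auto
      show "B \<nu> \<subseteq> {y \<in> ?V \<inter> interior Y. \<forall>k. \<bar>y $ k - \<gamma> $ k\<bar> \<le> t / 2}"
      proof
        fix y assume y: "y \<in> B \<nu>"
        then have y1: "t * real (\<nu> k) \<le> y $ k - b $ k" and y2: "y $ k - b $ k \<le> t * (real (\<nu> k) + 1)" for k
          by (auto simp: B_def mult.commute)
        have "c $ k \<le> y $ k \<and> y $ k \<le> c $ k + s" for k
          using y1[of k] y2[of k] lo[of k] hi[of k] by (simp add: c_def)
        moreover have "\<bar>y $ k - \<gamma> $ k\<bar> \<le> t / 2" for k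
          unfolding abs_le_iff using y1[of k] y2[of k] by (simp add: \<gamma>_def algebra_simps)
        ultimately show "y \<in> {y \<in> ?V \<inter> interior Y. \<forall>k. \<bar>y $ k - \<gamma> $ k\<bar> \<le> t / 2}"
          using y by (auto simp: B_def mem_hypercube)
      qed
    qed simp
  qed
  have cover: "?B \<subseteq> (\<Union>\<nu>\<in>\<Gamma>. B \<nu>)"
  proof
    fix y assume y: "y \<in> ?B"
    define \<nu> where "\<nu> k = nat \<lfloor>(y $ k - b $ k) / t\<rfloor>" for k
    have pos: "0 \<le> (y $ k - b $ k) / t" for k
      using y t by (auto simp: Y mem_interior_hypercube intro!: less_imp_le)
    have fl: "real (\<nu> k) = of_int \<lfloor>(y $ k - b $ k) / t\<rfloor>" for k
      using pos[of k] by (simp add: \<nu>_def)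
    have lo: "real (\<nu> k) \<le> (y $ k - b $ k) / t" and hi: "(y $ k - b $ k) / t < real (\<nu> k) + 1" for k
      unfolding fl by linarith+
    have "y \<in> B \<nu>"
      using y lo hi t by (auto simp: B_def field_simps intro: less_imp_le)
    moreover have "\<nu> \<in> cells"
    proof -
      have "\<nu> k < (if k \<in> D then m * 2 ^ i else 2 * m)" for k
      proof -
        have "y $ k - b $ k < t * real (if k \<in> D then m * 2 ^ i else 2 * m)"
        proof (cases "k \<in> D")
          case True
          have "y $ k - b $ k < r" using y by (simp add: Y mem_interior_hypercube diff_less_eq add.commute)
          then show ?thesis using True by (simp add: rs smt mult_ac)
        next
          case False
          then have "y $ k - b $ k < 2 * s" using y by (simp add: s_def)
          then show ?thesis using False by (simp add: smt mult_ac)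
        qed
        then have "(y $ k - b $ k) / t < real (if k \<in> D then m * 2 ^ i else 2 * m)"
          using t by (simp only: pos_divide_less_eq mult.commute)
        then show ?thesis using lo[of k] by linarith
      qed
      then show ?thesis by (simp add: cells_def PiE_iff)
    qed
    moreover obtain k where k: "k \<notin> D" "s \<le> y $ k - b $ k" using y by (auto simp: s_def)
    have "real m \<le> (y $ k - b $ k) / t" using k(2) t by (simp add: smt field_simps)
    then have "m \<le> \<nu> k" using hi[of k] by linarith
    ultimately show "y \<in> (\<Union>\<nu>\<in>\<Gamma>. B \<nu>)" using k(1) by (auto simp: \<Gamma>_def)
  qed
  have fin: "finite \<Gamma>" unfolding \<Gamma>_def using fin_cells by simp
  have "eps_rank_le F (interior X) (\<Union>\<nu>\<in>\<Gamma>. B \<nu>) ?\<epsilon> (\<Sum>\<nu>\<in>\<Gamma>. 2 * p ^ CARD('d))"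
    by (intro eps_rank_le_UN fin cell \<epsilon>)
  then show ?thesis
    by (rule eps_rank_le_mono[OF _ cover]) (use card in auto)
qed

text \<open>The exponent must be positive: for \<open>e = 0\<close> the sum would grow linearly in \<open>\<kappa>\<close>. With \<open>e\<close> the
  dimension of the shared surface, the last level dominates.\<close>
lemma sum_geometric_le_twice_last:
  assumes "1 \<le> e"
  shows "(\<Sum>i=1..\<kappa>. (2 ^ i) ^ e) \<le> 2 * ((2::nat) ^ \<kappa>) ^ e"
proof (induction \<kappa>)
  case (Suc \<kappa>)
  have "(2::nat) ^ 1 \<le> 2 ^ e" using assms by (intro power_increasing) auto
  then have "2 * ((2::nat) ^ \<kappa>) ^ e \<le> (2 ^ Suc \<kappa>) ^ e" by (simp add: power_mult_distrib)
  moreover have "(\<Sum>i=1..Suc \<kappa>. ((2::nat) ^ i) ^ e) = (\<Sum>i=1..\<kappa>. (2 ^ i) ^ e) + (2 ^ Suc \<kappa>) ^ e"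
    by simp
  ultimately show ?case using Suc.IH by linarith
qed simp

text \<open>A point belongs to the first level whose threshold \<open>r / 2 ^ i\<close> one of its transversal coordinates
  reaches.\<close>
lemma eps_rank_le_far:
  fixes F :: "real^'d \<Rightarrow> real^'d \<Rightarrow> real" and D :: "'d set"
  assumes margin: "bernstein_margin \<rho>\<^sub>0 \<eta>"
    and m: "0 < m" "6 \<le> \<eta> * real m"
    and "0 < r" and b: "b = a + shift D r" and X: "X = hypercube a r" and Y: "Y = hypercube b r"
    and cont: "analytic_continuation F X Y \<rho> M"
    and const: "continuation_constants X Y (r / real n) \<rho> M \<rho>\<^sub>0 M\<^sub>0" and "0 \<le> M\<^sub>0"
    and \<kappa>: "2 ^ \<kappa> \<le> n" and "1 \<le> card D"
  shows "eps_rank_le F (interior X) {y \<in> interior Y. \<exists>k. k \<notin> D \<and> r / 2 ^ \<kappa> \<le> y $ k - b $ k}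
           ((2 ^ CARD('d) - 1) * (6 * M\<^sub>0 / 2 ^ p))
           (4 * (2 * m) ^ CARD('d) * (2 ^ \<kappa>) ^ card D * p ^ CARD('d))"
proof -
  let ?\<epsilon> = "(2 ^ CARD('d) - 1) * (6 * M\<^sub>0 / 2 ^ p)"
  define B where "B i = {y \<in> interior Y. (\<forall>k. k \<notin> D \<longrightarrow> y $ k - b $ k < 2 * r / 2 ^ i) \<and>
                            (\<exists>k. k \<notin> D \<and> r / 2 ^ i \<le> y $ k - b $ k)}" for i
  have \<epsilon>: "0 \<le> ?\<epsilon>"
    using \<open>0 \<le> M\<^sub>0\<close> by (intro mult_nonneg_nonneg divide_nonneg_nonneg) auto
  define R where "R i = (2 * m) ^ CARD('d) * (2 ^ i) ^ card D * (2 * p ^ CARD('d))" for i :: nat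
  have level: "eps_rank_le F (interior X) (B i) ?\<epsilon> (R i)" if "i \<in> {1..\<kappa>}" for i
  proof -
    have "(2::nat) ^ i \<le> 2 ^ \<kappa>" using that by (intro power_increasing) auto
    then have "2 ^ i \<le> n" by (rule order_trans[OF _ \<kappa>])
    then show ?thesis
      unfolding B_def R_def using that
      by (intro eps_rank_le_on_level[OF margin m \<open>0 < r\<close> b X Y cont const \<open>0 \<le> M\<^sub>0\<close>]) auto
  qed
  have cover: "{y \<in> interior Y. \<exists>k. k \<notin> D \<and> r / 2 ^ \<kappa> \<le> y $ k - b $ k} \<subseteq> (\<Union>i\<in>{1..\<kappa>}. B i)"
  proof
    fix y assume y: "y \<in> {y \<in> interior Y. \<exists>k. k \<notin> D \<and> r / 2 ^ \<kappa> \<le> y $ k - b $ k}"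
    define P where "P i \<longleftrightarrow> (\<exists>k. k \<notin> D \<and> r / 2 ^ i \<le> y $ k - b $ k)" for i :: nat
    define i where "i = (LEAST i. P i)"
    have "P \<kappa>" using y by (simp add: P_def)
    then have Pi: "P i" and i\<kappa>: "i \<le> \<kappa>" unfolding i_def by (auto intro: LeastI Least_le)
    have "\<not> P 0"
    proof
      assume "P 0"
      then obtain k where "r \<le> y $ k - b $ k" by (auto simp: P_def)
      moreover have "y $ k < b $ k + r" using y by (simp add: Y mem_interior_hypercube)
      ultimately show False by linarith
    qed
    then obtain l where l: "i = Suc l" using Pi by (cases i) auto
    then have "\<not> P l" unfolding i_def using not_less_Least[of l P] by simp
    then have "\<forall>k. k \<notin> D \<longrightarrow> y $ k - b $ k < 2 * r / 2 ^ i"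
      by (auto simp: P_def l not_le)
    then have "y \<in> B i" using y Pi by (simp add: B_def P_def)
    then show "y \<in> (\<Union>i\<in>{1..\<kappa>}. B i)" using l i\<kappa> by auto
  qed
  have ranks: "eps_rank_le F (interior X) (\<Union>i\<in>{1..\<kappa>}. B i) ?\<epsilon> (\<Sum>i\<in>{1..\<kappa>}. R i)"
    by (intro eps_rank_le_UN level \<epsilon>) simp_all
  have "(\<Sum>i\<in>{1..\<kappa>}. R i) \<le> 4 * (2 * m) ^ CARD('d) * (2 ^ \<kappa>) ^ card D * p ^ CARD('d)"
  proof -
    have "(\<Sum>i\<in>{1..\<kappa>}. R i) = (2 * m) ^ CARD('d) * (2 * p ^ CARD('d)) * (\<Sum>i=1..\<kappa>. (2 ^ i) ^ card D)"
      by (simp add: R_def sum_distrib_left mult_ac)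
    also have "\<dots> \<le> (2 * m) ^ CARD('d) * (2 * p ^ CARD('d)) * (2 * (2 ^ \<kappa>) ^ card D)"
      by (intro mult_left_mono sum_geometric_le_twice_last \<open>1 \<le> card D\<close>) auto
    finally show ?thesis by (simp add: mult_ac)
  qed
  then show ?thesis by (rule eps_rank_le_mono[OF ranks cover order_refl])
qed

text \<open>Each grid cell holds one source, so it suffices to count the grid cells of the layer: \<open>n\<close>
  positions in a direction of \<open>D\<close> and \<open>w\<close> in any other direction.\<close>
lemma card_sources_near_le:
  fixes y :: "nat \<Rightarrow> real^'d"
  assumes ud: "uniformly_distributed n b r y" and "0 < r" "0 < n"
  shows "card (y ` {j. j < n ^ CARD('d) \<and> (\<forall>k. k \<notin> D \<longrightarrow> y j $ k - b $ k < r * real w / real n)})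
           \<le> n ^ card D * w ^ (CARD('d) - card D)"
proof -
  let ?J = "{j. j < n ^ CARD('d) \<and> (\<forall>k. k \<notin> D \<longrightarrow> y j $ k - b $ k < r * real w / real n)}"
  define cell where "cell j k = nat \<lfloor>real n * (y j $ k - b $ k) / r\<rfloor>" for j k
  have inside: "0 < y j $ k - b $ k" "y j $ k - b $ k < r" if "j < n ^ CARD('d)" for j k
  proof -
    have "y j \<in> interior (hypercube b r)"
      using ud that unfolding uniformly_distributed_def by blast
    then have "b $ k < y j $ k \<and> y j $ k < b $ k + r" by (simp add: mem_interior_hypercube)
    then show "0 < y j $ k - b $ k" "y j $ k - b $ k < r" by linarith+
  qed
  have fl: "real (cell j k) \<le> real n * (y j $ k - b $ k) / r"
           "real n * (y j $ k - b $ k) / r < real (cell j k) + 1" if "j < n ^ CARD('d)" for j k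
  proof -
    have "0 \<le> real n * (y j $ k - b $ k) / r" using inside[OF that, of k] \<open>0 < r\<close> by simp
    then have "real (cell j k) = of_int \<lfloor>real n * (y j $ k - b $ k) / r\<rfloor>" by (simp add: cell_def)
    then show "real (cell j k) \<le> real n * (y j $ k - b $ k) / r"
           "real n * (y j $ k - b $ k) / r < real (cell j k) + 1" by linarith+
  qed
  have cell_n: "cell j k < n" if "j < n ^ CARD('d)" for j k
  proof -
    have "real n * (y j $ k - b $ k) / r < real n"
      using inside(2)[OF that, of k] \<open>0 < r\<close> \<open>0 < n\<close> by (simp add: pos_divide_less_eq)
    then show ?thesis using fl(1)[OF that, of k] by linarith
  qed
  have in_cell: "b $ k + r * real (cell j k) / real n \<le> y j $ k \<and>
                 y j $ k < b $ k + r * (real (cell j k) + 1) / real n" if "j < n ^ CARD('d)" for j k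
    using fl[OF that, of k] \<open>0 < r\<close> \<open>0 < n\<close> by (simp add: field_simps)
  have "inj_on cell ?J"
  proof (rule inj_onI)
    fix i j assume "i \<in> ?J" "j \<in> ?J" and eq: "cell i = cell j"
    then have ij: "i < n ^ CARD('d)" "j < n ^ CARD('d)" by auto
    have "\<exists>!l. l < n ^ CARD('d) \<and> (\<forall>k. b $ k + r * real (cell j k) / real n \<le> y l $ k \<and>
               y l $ k < b $ k + r * (real (cell j k) + 1) / real n)"
      using ud cell_n[OF ij(2)] unfolding uniformly_distributed_def by blast
    moreover have "\<forall>k. b $ k + r * real (cell j k) / real n \<le> y i $ k \<and>
               y i $ k < b $ k + r * (real (cell j k) + 1) / real n"
      using in_cell[OF ij(1)] unfolding eq by blast
    ultimately show "i = j" using in_cell[OF ij(2)] ij by blast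
  qed
  moreover have sub: "cell ` ?J \<subseteq> PiE UNIV (\<lambda>k. {..<(if k \<in> D then n else w)})"
  proof (intro image_subsetI)
    fix j assume j: "j \<in> ?J"
    have "cell j k < w" if "k \<notin> D" for k
    proof -
      have "real n * (y j $ k - b $ k) / r < real w"
        using j that \<open>0 < r\<close> \<open>0 < n\<close> by (auto simp: field_simps)
      then show ?thesis using fl(1)[of j k] j by auto
    qed
    then show "cell j \<in> PiE UNIV (\<lambda>k. {..<(if k \<in> D then n else w)})"
      using j cell_n by auto
  qed
  moreover have "finite (PiE (UNIV :: 'd set) (\<lambda>k. {..<(if k \<in> D then n else w)}))"
    by (intro finite_PiE) auto
  ultimately have "card ?J \<le> card (PiE (UNIV :: 'd set) (\<lambda>k. {..<(if k \<in> D then n else w)}))"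
    by (intro card_inj_on_le)
  also have "\<dots> = n ^ card D * w ^ (CARD('d) - card D)"
    by (simp add: card_PiE if_distrib prod.If_cases card_Diff_subset Compl_eq_Diff_UNIV)
  finally have "card ?J \<le> n ^ card D * w ^ (CARD('d) - card D)" .
  moreover have "card (y ` ?J) \<le> card ?J" by (rule card_image_le) simp
  ultimately show ?thesis by linarith
qed

section \<open>The rank bound\<close>

text \<open>The subdivision stops at the level \<open>\<kappa>\<close> with \<open>2 ^ \<kappa> \<le> n / p < 2 ^ (\<kappa> + 1)\<close>, where a cube holds about
  \<open>p ^ d\<close> sources and interpolation no longer saves anything over copying them. The far part then costs
  \<open>(2 ^ \<kappa>) ^ d' p ^ d \<le> n ^ d' p ^ (d - d')\<close> up to a constant, and the remaining layer is \<open>2 p\<close> grid cells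
  thick, so it holds at most \<open>n ^ d' (2 p) ^ (d - d')\<close> sources.\<close>
lemma kernel_matrix_approximation:
  fixes F :: "real^'d \<Rightarrow> real^'d \<Rightarrow> real" and D :: "'d set"
  assumes margin: "bernstein_margin \<rho>\<^sub>0 \<eta>" and m: "0 < m" "6 \<le> \<eta> * real m"
    and "0 < r" and b: "b = a + shift D r" and X: "X = hypercube a r" and Y: "Y = hypercube b r"
    and cont: "analytic_continuation F X Y \<rho> M"
    and const: "continuation_constants X Y (r / real n) \<rho> M \<rho>\<^sub>0 M\<^sub>0" and "0 \<le> M\<^sub>0"
    and ud: "uniformly_distributed n b r y" and x: "x ` {..<T} \<subseteq> interior X"
    and "1 \<le> card D" and p: "1 \<le> p" "p \<le> n"
  obtains K' where "K' \<in> carrier_mat T (n ^ CARD('d))"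
    "mat_rank K' \<le> (4 * (2 * m) ^ CARD('d) + 2 ^ CARD('d)) * n ^ card D * p ^ (CARD('d) - card D)"
    "\<And>i j. i < T \<Longrightarrow> j < n ^ CARD('d) \<Longrightarrow>
       \<bar>(kernel_matrix F T (n ^ CARD('d)) x y - K') $$ (i, j)\<bar> \<le> (2 ^ CARD('d) - 1) * (6 * M\<^sub>0 / 2 ^ p)"
proof -
  let ?d = "CARD('d)" and ?e = "CARD('d) - card D"
  let ?\<epsilon> = "(2 ^ ?d - 1) * (6 * M\<^sub>0 / 2 ^ p)"
  have card_D: "card D \<le> ?d" by (simp add: card_mono)
  have "1 \<le> n div p" using p by (simp add: Suc_le_eq div_greater_zero_iff)
  then obtain \<kappa> where \<kappa>: "2 ^ \<kappa> \<le> n div p" "n div p < 2 ^ (\<kappa> + 1)"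
    using ex_power_ivl1[of 2 "n div p"] by auto
  have "2 ^ \<kappa> * p \<le> n div p * p" using \<kappa>(1) by (rule mult_right_mono) simp
  then have \<kappa>p: "2 ^ \<kappa> * p \<le> n" using div_times_less_eq_dividend[of n p] by linarith
  have \<kappa>n: "2 ^ \<kappa> \<le> n" by (rule order_trans[OF \<kappa>(1) div_le_dividend])
  have np: "n < 2 ^ (\<kappa> + 1) * p" using \<kappa>(2) p(1) by (simp add: div_less_iff_less_mult)
  define far where "far = {v \<in> interior Y. \<exists>k. k \<notin> D \<and> r / 2 ^ \<kappa> \<le> v $ k - b $ k}"
  define near where "near = y ` {j. j < n ^ ?d \<and>
     (\<forall>k. k \<notin> D \<longrightarrow> y j $ k - b $ k < r * real (2 * p) / real n)}"
  have far: "eps_rank_le F (interior X) far ?\<epsilon> (4 * (2 * m) ^ ?d * n ^ card D * p ^ ?e)"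
  proof -
    have "(2 ^ \<kappa>) ^ card D * p ^ ?d = (2 ^ \<kappa> * p) ^ card D * p ^ ?e"
      using card_D by (simp add: power_mult_distrib power_add[symmetric])
    also have "\<dots> \<le> n ^ card D * p ^ ?e"
      by (intro mult_right_mono power_mono \<kappa>p) auto
    finally have "4 * (2 * m) ^ ?d * ((2 ^ \<kappa>) ^ card D * p ^ ?d) \<le> 4 * (2 * m) ^ ?d * (n ^ card D * p ^ ?e)"
      by (rule mult_left_mono) simp
    then have "4 * (2 * m) ^ ?d * (2 ^ \<kappa>) ^ card D * p ^ ?d \<le> 4 * (2 * m) ^ ?d * n ^ card D * p ^ ?e"
      by (simp only: mult.assoc)
    then show ?thesis
      unfolding far_def
      by (rule eps_rank_le_mono[OF eps_rank_le_far[OF margin m \<open>0 < r\<close> b X Y cont const \<open>0 \<le> M\<^sub>0\<close> \<kappa>n \<open>1 \<le> card D\<close>]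
            order_refl order_refl])
  qed
  have near: "eps_rank_le F (interior X) near ?\<epsilon> (n ^ card D * (2 * p) ^ ?e)"
  proof (rule eps_rank_le_mono[OF eps_rank_le_card])
    show "finite near" by (simp add: near_def)
    show "0 \<le> ?\<epsilon>"
      using \<open>0 \<le> M\<^sub>0\<close> by (intro mult_nonneg_nonneg divide_nonneg_nonneg) auto
    show "card near \<le> n ^ card D * (2 * p) ^ ?e"
      unfolding near_def by (rule card_sources_near_le[OF ud \<open>0 < r\<close>]) (use p in simp)
  qed auto
  have cover: "y ` {..<n ^ ?d} \<subseteq> far \<union> near"
  proof (intro image_subsetI)
    fix j assume "j \<in> {..<n ^ ?d}"
    then have j: "j < n ^ ?d" by simp
    have yY: "y j \<in> interior Y" using ud j unfolding uniformly_distributed_def Y by blast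
    show "y j \<in> far \<union> near"
    proof (cases "\<exists>k. k \<notin> D \<and> r / 2 ^ \<kappa> \<le> y j $ k - b $ k")
      case True
      then show ?thesis using yY by (simp add: far_def)
    next
      case False
      have "real n \<le> 2 ^ \<kappa> * real (2 * p)"
      proof -
        have "real n \<le> real (2 ^ (\<kappa> + 1) * p)" using np by (simp only: of_nat_le_iff)
        then show ?thesis by simp
      qed
      then have "r * real n \<le> r * (2 ^ \<kappa> * real (2 * p))"
        using \<open>0 < r\<close> by (intro mult_left_mono) auto
      then have "r / 2 ^ \<kappa> \<le> r * real (2 * p) / real n"
        using p by (simp add: field_simps)
      then have "y j $ k - b $ k < r * real (2 * p) / real n" if "k \<notin> D" for k
        using False that less_le_trans[of "y j $ k - b $ k" "r / 2 ^ \<kappa>"] by (auto simp: not_le)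
      then show ?thesis using j by (auto simp: near_def)
    qed
  qed
  have "eps_rank_le F (interior X) (far \<union> near) ?\<epsilon>
      (4 * (2 * m) ^ ?d * n ^ card D * p ^ ?e + n ^ card D * (2 * p) ^ ?e)"
    by (rule eps_rank_le_Un[OF far near])
  from eps_rank_le_imp_kernel_matrix[OF this x cover] obtain K' where
    K': "K' \<in> carrier_mat T (n ^ ?d)"
      "mat_rank K' \<le> 4 * (2 * m) ^ ?d * n ^ card D * p ^ ?e + n ^ card D * (2 * p) ^ ?e"
      "\<And>i j. i < T \<Longrightarrow> j < n ^ ?d \<Longrightarrow> \<bar>(kernel_matrix F T (n ^ ?d) x y - K') $$ (i, j)\<bar> \<le> ?\<epsilon>"
    by blast
  have "(2::nat) ^ ?e \<le> 2 ^ ?d" by (intro power_increasing) auto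
  then have "2 ^ ?e * (n ^ card D * p ^ ?e) \<le> 2 ^ ?d * (n ^ card D * p ^ ?e)"
    by (rule mult_right_mono) simp
  moreover have "n ^ card D * (2 * p) ^ ?e = 2 ^ ?e * (n ^ card D * p ^ ?e)"
    by (simp add: power_mult_distrib mult_ac)
  moreover have "(4 * (2 * m) ^ ?d + 2 ^ ?d) * n ^ card D * p ^ ?e
      = 4 * (2 * m) ^ ?d * n ^ card D * p ^ ?e + 2 ^ ?d * (n ^ card D * p ^ ?e)"
    by (simp only: add_mult_distrib mult.assoc)
  ultimately have "mat_rank K' \<le> (4 * (2 * m) ^ ?d + 2 ^ ?d) * n ^ card D * p ^ ?e"
    using K'(2) by linarith
  then show ?thesis using that K' by blast
qed

text \<open>With \<open>R = N / \<delta> \<ge> N \<ge> 2\<close> the assumption on \<open>p\<close> says \<open>2 ^ p \<ge> R ^ (q + 1 + c)\<close>. The factor \<open>R ^ q\<close> absorbs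
  \<open>N ^ q\<close>, the factor \<open>R ^ c \<ge> 2 ^ c\<close> absorbs the constant \<open>B\<close>, and \<open>\<delta> R = N \<ge> 1\<close>.\<close>
lemma order_sufficient:
  fixes B \<delta> :: real and N q c p :: nat
  assumes "B < 2 ^ c" "0 < \<delta>" "\<delta> \<le> 1" "2 \<le> N"
    and p: "real (q + 1 + c) / ln 2 * ln (real N / \<delta>) \<le> real p"
  shows "B * real N ^ q / 2 ^ p < \<delta>"
proof -
  define R where "R = real N / \<delta>"
  have RN: "real N \<le> R" using assms by (simp add: R_def field_simps mult_left_le)
  then have R: "2 \<le> R" using assms by simp
  have "B * real N ^ q < 2 ^ c * real N ^ q"
    using assms by (intro mult_strict_right_mono) auto
  also have "\<dots> \<le> R ^ c * R ^ q"
    using R RN by (intro mult_mono power_mono) auto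
  also have "\<dots> \<le> R ^ c * R ^ q * (\<delta> * R)"
  proof -
    have "1 \<le> \<delta> * R" using assms by (simp add: R_def)
    then have "R ^ c * R ^ q * 1 \<le> R ^ c * R ^ q * (\<delta> * R)"
      using R by (intro mult_left_mono) auto
    then show ?thesis by simp
  qed
  also have "\<dots> = \<delta> * R ^ (q + 1 + c)" by (simp add: power_add)
  also have "R ^ (q + 1 + c) = exp (real (q + 1 + c) * ln R)"
    using R by (simp only: exp_of_nat_mult) simp
  also have "\<dots> \<le> exp (real p * ln 2)"
    using p by (simp add: R_def field_simps)
  also have "\<dots> = 2 ^ p" by (simp only: exp_of_nat_mult) simp
  finally show ?thesis using assms(2) by (simp add: pos_divide_less_eq)
qed

theorem theorem4p3:
  fixes D :: "'d::finite set" and d' q :: nat and \<rho>\<^sub>0 A :: real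
  assumes "card D = d'" and "1 \<le> d'" and "d' \<le> CARD('d) - 1" and "1 < \<rho>\<^sub>0" and "0 < A"
  shows "\<exists>C :: real. \<forall>(r :: real) (a :: real^'d) b X Y (F :: real^'d \<Rightarrow> real^'d \<Rightarrow> real) \<rho> M
      (n :: nat) N (T :: nat) x y K (\<delta> :: real).
    0 < r \<and> b = a + shift D r \<and> X = hypercube a r \<and> Y = hypercube b r \<and>
    analytic_continuation F X Y \<rho> M \<and>
    N = n ^ CARD('d) \<and> uniformly_distributed n b r y \<and>
    1 \<le> T \<and> inj_on x {..<T} \<and> x ` {..<T} \<subseteq> interior X \<and>
    K = kernel_matrix F T N x y \<and> 0 < max_norm K \<and>
    continuation_constants X Y (r / real n) \<rho> M \<rho>\<^sub>0 (A * real N ^ q * max_norm K) \<and>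
    0 < \<delta> \<and> 2 \<le> N \<and> \<delta> \<le> real N \<longrightarrow>
    (\<exists>K' \<in> carrier_mat T N.
       max_norm (K - K') / max_norm K < \<delta> \<and>
       real (mat_rank K') \<le>
         C * (real N powr (real d' / real CARD('d)) * ln (real N / \<delta>) ^ (CARD('d) - d')))"
proof -
  let ?d = "CARD('d)" and ?e = "CARD('d) - d'"
  obtain \<eta> where "0 < \<eta>" and margin: "bernstein_margin \<rho>\<^sub>0 \<eta>"
    using bernstein_margin_exists[OF \<open>1 < \<rho>\<^sub>0\<close>] .
  \<comment> \<open>cells of side \<open>s / m\<close> have room for polydiscs of radius \<open>3 s / m \<le> \<eta> s / 2\<close>\<close>
  obtain m where m: "6 / \<eta> < real m" using reals_Archimedean2 by blast
  then have m0: "0 < m" using less_trans[OF _ m, of 0] \<open>0 < \<eta>\<close> by simp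
  have m6: "6 \<le> \<eta> * real m" using m \<open>0 < \<eta>\<close> by (simp add: field_simps)
  obtain c where c: "(2 ^ ?d - 1) * 6 * A < 2 ^ c" using real_arch_pow[of 2] by auto
  define c1 where "c1 = real (q + 1 + c) / ln 2"
  have c1: "0 < c1" by (simp add: c1_def)
  define C\<^sub>0 where "C\<^sub>0 = 4 * (2 * m) ^ ?d + 2 ^ ?d"
  define C where "C = real C\<^sub>0 * (c1 + 1 / ln 2) ^ ?e"
  have "1 \<le> C\<^sub>0" unfolding C\<^sub>0_def by (rule trans_le_add2) simp
  have "0 \<le> C" using c1 by (simp add: C_def)
  have main: "\<exists>K' \<in> carrier_mat T N.
       max_norm (K - K') / max_norm K < \<delta> \<and>
       real (mat_rank K') \<le>
         C * (real N powr (real d' / real ?d) * ln (real N / \<delta>) ^ ?e)"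
    if "0 < r" and b: "b = a + shift D r" and X: "X = hypercube a r" and Y: "Y = hypercube b r"
      and cont: "analytic_continuation F X Y \<rho> M"
      and N: "N = n ^ ?d" and ud: "uniformly_distributed n b r y"
      and "1 \<le> T" and x: "x ` {..<T} \<subseteq> interior X"
      and K: "K = kernel_matrix F T N x y" and K0: "0 < max_norm K"
      and const: "continuation_constants X Y (r / real n) \<rho> M \<rho>\<^sub>0 (A * real N ^ q * max_norm K)"
      and "0 < \<delta>" "2 \<le> N" "\<delta> \<le> real N"
    for r :: real and a :: "real^'d" and b X Y and F :: "real^'d \<Rightarrow> real^'d \<Rightarrow> real"
      and \<rho> M and n :: nat and N and T :: nat and x y K and \<delta> :: real
  proof (cases "\<delta> \<le> 1")
    case False
    \<comment> \<open>the logarithm may be 0 here, so the approximation must have rank 0\<close>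
    have "K \<in> carrier_mat T N" by (simp add: K kernel_matrix_def)
    then have "K - 0\<^sub>m T N = K" by auto
    moreover have "vec_space.rank T (0\<^sub>m T N :: real mat) = 0" by (rule vec_space.rank_0I)
    moreover have "0 \<le> ln (real N / \<delta>)" using \<open>0 < \<delta>\<close> \<open>\<delta> \<le> real N\<close> by simp
    ultimately show ?thesis
      using False K0 \<open>0 \<le> C\<close> by (intro bexI[of _ "0\<^sub>m T N"]) auto
  next
    case True
    define L where "L = ln (real N / \<delta>)"
    have "2 \<le> real N / \<delta>"
    proof -
      have "2 * \<delta> \<le> real N" using True \<open>2 \<le> N\<close> by linarith
      then show ?thesis using \<open>0 < \<delta>\<close> by (simp add: pos_le_divide_eq)
    qed
    then have L: "ln 2 \<le> L" unfolding L_def by (subst ln_le_cancel_iff) auto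
    have L0: "0 < L" using L ln_gt_zero[of "2::real"] by linarith
    define p where "p = nat \<lceil>c1 * L\<rceil>"
    have cL: "0 < c1 * L" using c1 L0 by simp
    then have real_p: "real p = of_int \<lceil>c1 * L\<rceil>" by (simp add: p_def)
    have p_ge: "c1 * L \<le> real p" unfolding real_p by linarith
    then have p1: "1 \<le> p" using cL by (cases p) auto
    have "1 \<le> 1 / ln 2 * L" using L by (simp add: pos_le_divide_eq)
    \<comment> \<open>\<open>L \<ge> ln 2\<close> lets a multiple of \<open>L\<close> absorb the rounding error 1\<close>
    then have p_le: "real p \<le> (c1 + 1 / ln 2) * L"
      unfolding distrib_right real_p by linarith
    have n0: "0 < n" using N \<open>2 \<le> N\<close> by (cases n) (simp_all add: zero_power)
    have Nn: "real N powr (real d' / real ?d) = real n ^ d'"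
    proof -
      have "real N = real n powr real ?d" using n0 by (simp add: N powr_realpow)
      then have "real N powr (real d' / real ?d) = real n powr real d'" by (simp add: powr_powr)
      also have "\<dots> = real n ^ d'" by (rule powr_realpow) (use n0 in simp)
      finally show ?thesis .
    qed
    have bound: "real (C\<^sub>0 * n ^ d' * p ^ ?e) \<le> C * (real N powr (real d' / real ?d) * L ^ ?e)"
    proof -
      have "real p ^ ?e \<le> ((c1 + 1 / ln 2) * L) ^ ?e" using p_le by (intro power_mono) auto
      then have "real C\<^sub>0 * real n ^ d' * real p ^ ?e \<le> real C\<^sub>0 * real n ^ d' * ((c1 + 1 / ln 2) * L) ^ ?e"
        by (intro mult_left_mono) auto
      then show ?thesis by (simp add: C_def Nn power_mult_distrib mult_ac)
    qed
    show ?thesis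
    proof (cases "p \<le> n")
      case False
      \<comment> \<open>\<open>p\<close> exceeds the grid size, and the \<open>n ^ d\<close> columns of \<open>K\<close> itself are within the bound\<close>
      have KC: "K \<in> carrier_mat T N" by (simp add: K kernel_matrix_def)
      have "mat_rank K \<le> N" using vec_space.rank_le_nc[OF KC] KC by simp
      also have "N = n ^ d' * n ^ ?e"
        using assms(3) by (simp add: N power_add[symmetric])
      also have "\<dots> \<le> n ^ d' * p ^ ?e" using False by (intro mult_left_mono power_mono) auto
      also have "\<dots> \<le> C\<^sub>0 * (n ^ d' * p ^ ?e)" using \<open>1 \<le> C\<^sub>0\<close> by simp
      finally have "real (mat_rank K) \<le> real (C\<^sub>0 * n ^ d' * p ^ ?e)"
        by (simp only: of_nat_le_iff mult.assoc)
      moreover have "max_norm (K - K) < \<delta> * max_norm K"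
        by (rule max_norm_less) (use KC \<open>1 \<le> T\<close> \<open>2 \<le> N\<close> \<open>0 < \<delta>\<close> K0 in auto)
      ultimately show ?thesis
        using KC K0 bound unfolding L_def
        by (intro bexI[of _ K]) (auto simp: pos_divide_less_eq intro: order_trans)
    next
      case True
      let ?M = "A * real N ^ q * max_norm K"
      have M0: "0 \<le> ?M" using \<open>0 < A\<close> K0 by simp
      have D1: "1 \<le> card D" using assms by simp
      obtain K' where K': "K' \<in> carrier_mat T N"
        and rank: "mat_rank K' \<le> C\<^sub>0 * n ^ d' * p ^ ?e"
        and err: "\<And>i j. i < T \<Longrightarrow> j < N \<Longrightarrow> \<bar>(K - K') $$ (i, j)\<bar> \<le> (2 ^ ?d - 1) * (6 * ?M / 2 ^ p)"
        by (rule kernel_matrix_approximation[OF margin m0 m6 \<open>0 < r\<close> b X Y cont const M0 ud x D1 p1 True,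
              unfolded assms(1), folded C\<^sub>0_def, folded N, folded K]) blast
      have "(2 ^ ?d - 1) * 6 * A * real N ^ q / 2 ^ p < \<delta>"
        by (rule order_sufficient[OF c \<open>0 < \<delta>\<close> \<open>\<delta> \<le> 1\<close> \<open>2 \<le> N\<close>])
           (use p_ge in \<open>simp add: c1_def L_def\<close>)
      then have "(2 ^ ?d - 1) * 6 * A * real N ^ q / 2 ^ p * max_norm K < \<delta> * max_norm K"
        using K0 by (rule mult_strict_right_mono)
      moreover have "u * 6 * A * v / w * k = u * (6 * (A * v * k) / w)" for u v w k :: real
        by simp
      ultimately have small: "(2 ^ ?d - 1) * (6 * ?M / 2 ^ p) < \<delta> * max_norm K"
        by (simp only:)
      have "max_norm (K - K') < \<delta> * max_norm K"
      proof (rule max_norm_less)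
        show "\<bar>(K - K') $$ (i, j)\<bar> < \<delta> * max_norm K"
          if "i < dim_row (K - K')" "j < dim_col (K - K')" for i j
          using le_less_trans[OF err small, of i j] that K' by simp
      qed (use K' \<open>1 \<le> T\<close> \<open>2 \<le> N\<close> in auto)
      moreover have "real (mat_rank K') \<le> real (C\<^sub>0 * n ^ d' * p ^ ?e)"
        using rank by (simp only: of_nat_le_iff)
      ultimately show ?thesis
        using K' K0 bound unfolding L_def
        by (intro bexI[of _ K']) (auto simp: pos_divide_less_eq intro: order_trans)
    qed
  qed
  show ?thesis
    by (intro exI[of _ C] allI impI, elim conjE) (rule main; assumption)
qed

end
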